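(* Let $\beta\ge5$, $\epsilon_1\in\{0,1\}$ and $\epsilon_2\in\{1,-1\}$. (a) There is no tight chiral $4$-polytope of type $\{2^{\beta-1},2^\beta,8\}$ whose standard generators satisfy $\sigma_2\sigma_1^{-1}=\sigma_1\sigma_2^{3-\epsilon_12^{\beta-1}}$ and $\sigma_2\sigma_3^2=\sigma_3^2\sigma_2^{1+\epsilon_22^{\beta-2}}$. (b) There is no tight chiral $4$-polytope of type $\{2^{\beta-1},2^\beta,2^{\beta-1}\}$ whose standard generators satisfy $\sigma_2\sigma_1^{-1}=\sigma_1\sigma_2^{3-\epsilon_12^{\beta-1}}$, $\sigma_3^{-1}\sigma_2=\sigma_2^{3+\epsilon_22^{\beta-2}}\sigma_3^{1-2^{\beta-2}}$ and $\sigma_3\sigma_2^{-1}=\sigma_2^{-3+\epsilon_22^{\beta-2}}\sigma_3^{-1+2^{\beta-2}}$.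
   Context: For a chiral polytope with base flag $\Phi$, the standard generators $\sigma_1,\sigma_2,\sigma_3$ of its automorphism group are the automorphisms with $\Phi\sigma_i=\Phi^{i(i-1)}$, where $\Phi^j$ is the flag differing from $\Phi$ only in its $j$-face; for type $\{p,q,r\}$ they have orders $p,q,r$ and satisfy $(\sigma_1\sigma_2)^2=(\sigma_2\sigma_3)^2=(\sigma_1\sigma_2\sigma_3)^2=1$. Tight: type $\{p,q,r\}$ with exactly $2pqr$ flags. *)

theory Defs
  imports "HOL-Algebra.Group" "HOL-Algebra.Bij"
begin

text \<open>Abstract polytopes of rank 4, given by a carrier set P of faces and a
partial order leq on P (faces of rank -1 up to 4).\<close>

definition pchain :: "'a set \<Rightarrow> ('a \<Rightarrow> 'a \<Rightarrow> bool) \<Rightarrow> 'a set \<Rightarrow> bool" where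
  "pchain P leq C \<longleftrightarrow> C \<subseteq> P \<and> (\<forall>x\<in>C. \<forall>y\<in>C. leq x y \<or> leq y x)"

definition flag :: "'a set \<Rightarrow> ('a \<Rightarrow> 'a \<Rightarrow> bool) \<Rightarrow> 'a set \<Rightarrow> bool" where
  "flag P leq \<Phi> \<longleftrightarrow> pchain P leq \<Phi> \<and> (\<forall>C. pchain P leq C \<and> \<Phi> \<subseteq> C \<longrightarrow> C = \<Phi>)"

definition flags :: "'a set \<Rightarrow> ('a \<Rightarrow> 'a \<Rightarrow> bool) \<Rightarrow> 'a set set" where
  "flags P leq = {\<Phi>. flag P leq \<Phi>}"

definition rank :: "'a set \<Rightarrow> ('a \<Rightarrow> 'a \<Rightarrow> bool) \<Rightarrow> 'a \<Rightarrow> int" where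
  "rank P leq F = int (card {G \<in> (SOME \<Phi>. flag P leq \<Phi> \<and> F \<in> \<Phi>). leq G F \<and> G \<noteq> F}) - 1"

definition strongly_flag_connected :: "'a set \<Rightarrow> ('a \<Rightarrow> 'a \<Rightarrow> bool) \<Rightarrow> bool" where
  "strongly_flag_connected P leq \<longleftrightarrow>
     (\<forall>\<Phi> \<Psi>. flag P leq \<Phi> \<and> flag P leq \<Psi> \<longrightarrow>
        (\<lambda>A B. flag P leq A \<and> flag P leq B \<and> \<Phi> \<inter> \<Psi> \<subseteq> A \<and> \<Phi> \<inter> \<Psi> \<subseteq> B
               \<and> card (A - B) = 1)\<^sup>*\<^sup>* \<Phi> \<Psi>)"

definition polytope4 :: "'a set \<Rightarrow> ('a \<Rightarrow> 'a \<Rightarrow> bool) \<Rightarrow> bool" where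
  "polytope4 P leq \<longleftrightarrow>
     (\<forall>x\<in>P. leq x x) \<and>
     (\<forall>x\<in>P. \<forall>y\<in>P. leq x y \<and> leq y x \<longrightarrow> x = y) \<and>
     (\<forall>x\<in>P. \<forall>y\<in>P. \<forall>z\<in>P. leq x y \<and> leq y z \<longrightarrow> leq x z) \<and>
     (\<exists>m\<in>P. \<forall>x\<in>P. leq m x) \<and>
     (\<exists>m\<in>P. \<forall>x\<in>P. leq x m) \<and>
     (\<forall>\<Phi>. flag P leq \<Phi> \<longrightarrow> finite \<Phi> \<and> card \<Phi> = 6) \<and>
     (\<forall>F\<in>P. \<forall>G\<in>P. leq F G \<and> rank P leq G = rank P leq F + 2 \<longrightarrow>
        card {H \<in> P. leq F H \<and> leq H G \<and> H \<noteq> F \<and> H \<noteq> G} = 2) \<and>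
     strongly_flag_connected P leq"

text \<open>Automorphism group, acting on the right: in a product a b, first a then b,
 so that (Phi a) b = Phi (a b).\<close>
definition autgrp :: "'a set \<Rightarrow> ('a \<Rightarrow> 'a \<Rightarrow> bool) \<Rightarrow> ('a \<Rightarrow> 'a) monoid" where
  "autgrp P leq =
     \<lparr>carrier = {f \<in> Bij P. \<forall>x\<in>P. \<forall>y\<in>P. leq x y \<longleftrightarrow> leq (f x) (f y)},
      mult = (\<lambda>a b. compose P b a),
      one = (\<lambda>x\<in>P. x)\<rparr>"

definition adj_flag :: "'a set \<Rightarrow> ('a \<Rightarrow> 'a \<Rightarrow> bool) \<Rightarrow> 'a set \<Rightarrow> int \<Rightarrow> 'a set" where
  "adj_flag P leq \<Phi> j =
     (THE \<Psi>. flag P leq \<Psi> \<and> \<Psi> \<noteq> \<Phi> \<and> (\<forall>F\<in>\<Phi>. rank P leq F \<noteq> j \<longrightarrow> F \<in> \<Psi>))"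

definition flag_orbit :: "'a set \<Rightarrow> ('a \<Rightarrow> 'a \<Rightarrow> bool) \<Rightarrow> 'a set \<Rightarrow> 'a set set" where
  "flag_orbit P leq \<Phi> = (\<lambda>\<sigma>. \<sigma> ` \<Phi>) ` carrier (autgrp P leq)"

definition chiral4 :: "'a set \<Rightarrow> ('a \<Rightarrow> 'a \<Rightarrow> bool) \<Rightarrow> bool" where
  "chiral4 P leq \<longleftrightarrow> polytope4 P leq \<and>
     card (flag_orbit P leq ` flags P leq) = 2 \<and>
     (\<forall>\<Phi>. flag P leq \<Phi> \<longrightarrow>
        (\<forall>j\<in>{0..3}. adj_flag P leq \<Phi> j \<notin> flag_orbit P leq \<Phi>))"

text \<open>Schlaefli type {p,q,r}: every section G/F with rank F = i-2, rank G = i+1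
 is a polygon with p_i vertices (faces of rank i-1 between F and G).\<close>
definition has_type :: "'a set \<Rightarrow> ('a \<Rightarrow> 'a \<Rightarrow> bool) \<Rightarrow> nat \<Rightarrow> nat \<Rightarrow> nat \<Rightarrow> bool" where
  "has_type P leq p q r \<longleftrightarrow>
     (\<forall>F\<in>P. \<forall>G\<in>P. rank P leq F = -1 \<and> rank P leq G = 2 \<and> leq F G \<longrightarrow>
        card {H \<in> P. leq F H \<and> leq H G \<and> rank P leq H = 0} = p) \<and>
     (\<forall>F\<in>P. \<forall>G\<in>P. rank P leq F = 0 \<and> rank P leq G = 3 \<and> leq F G \<longrightarrow>
        card {H \<in> P. leq F H \<and> leq H G \<and> rank P leq H = 1} = q) \<and>
     (\<forall>F\<in>P. \<forall>G\<in>P. rank P leq F = 1 \<and> rank P leq G = 4 \<and> leq F G \<longrightarrow>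
        card {H \<in> P. leq F H \<and> leq H G \<and> rank P leq H = 2} = r)"

definition tight_of_type :: "'a set \<Rightarrow> ('a \<Rightarrow> 'a \<Rightarrow> bool) \<Rightarrow> nat \<Rightarrow> nat \<Rightarrow> nat \<Rightarrow> bool" where
  "tight_of_type P leq p q r \<longleftrightarrow> has_type P leq p q r \<and> card (flags P leq) = 2 * p * q * r"

definition std_gens :: "'a set \<Rightarrow> ('a \<Rightarrow> 'a \<Rightarrow> bool) \<Rightarrow> 'a set \<Rightarrow>
    ('a \<Rightarrow> 'a) \<Rightarrow> ('a \<Rightarrow> 'a) \<Rightarrow> ('a \<Rightarrow> 'a) \<Rightarrow> bool" where
  "std_gens P leq \<Phi> s1 s2 s3 \<longleftrightarrow> flag P leq \<Phi> \<and>
     s1 \<in> carrier (autgrp P leq) \<and> s2 \<in> carrier (autgrp P leq) \<and> s3 \<in> carrier (autgrp P leq) \<and>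
     s1 ` \<Phi> = adj_flag P leq (adj_flag P leq \<Phi> 1) 0 \<and>
     s2 ` \<Phi> = adj_flag P leq (adj_flag P leq \<Phi> 2) 1 \<and>
     s3 ` \<Phi> = adj_flag P leq (adj_flag P leq \<Phi> 3) 2"

end

theory Submission
  imports Defs "HOL-Algebra.Multiplicative_Group"
begin

text \<open>
  Write \<open>a, b, c\<close> for the standard generators and \<open>h = b ^ 2 ^ (\<beta> - 1)\<close>. The relations force
  \<open>h = 1\<close>, whereas \<open>b\<close> has order \<open>2 ^ \<beta>\<close>.

  From the involutory products and the relation between \<open>a\<close> and \<open>b\<close>, conjugation by \<open>inv a\<close> sends
  \<open>b ^ 2\<close> to \<open>b ^ 2\<close> or \<open>b ^ 2 * h\<close>, and \<open>c\<close> to \<open>b ^ 2 * c\<close>. Applying it to the formula for the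
  conjugate of \<open>b ^ 2\<close> under \<open>c\<close> shows in case (a) that \<open>c ^ 4\<close> commutes with \<open>a\<close>, and in case (b)
  that \<open>y = c ^ 2 ^ (\<beta> - 2)\<close> does. Computing the powers \<open>(b ^ 2 * c) ^ 4\<close> and
  \<open>(b ^ 2 * c) ^ 2 ^ (\<beta> - 2)\<close> directly gives \<open>c ^ 4 * h\<close> and \<open>h * y\<close> instead.

  The order of a standard generator is the number of vertices of the corresponding polygonal
  section: the cyclic group it generates acts on these vertices, transitively by strong
  flag-connectedness, and freely because a nontrivial element fixing a vertex would map the base
  flag to an adjacent flag, which chirality forbids.
\<close>

section \<open>Conjugation in groups\<close>

context group
begin

definition conj_by :: "'a \<Rightarrow> 'a \<Rightarrow> 'a" where
  "conj_by g x = g \<otimes> x \<otimes> inv g"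

text \<open>Rewriting with \<open>m_assoc\<close> nests products to the right, where
  \<open>x\<close> and its inverse are neighbours without forming a subterm of their own. This rule
  cancels them there; \<open>int_pow_mult_left\<close> likewise merges neighbouring powers.\<close>

lemma inv_cancel_left [simp]:
  assumes "x \<in> carrier G" "y \<in> carrier G"
  shows "inv x \<otimes> (x \<otimes> y) = y" "x \<otimes> (inv x \<otimes> y) = y"
  using assms by (simp_all add: m_assoc [symmetric])

lemma conj_by_closed [simp]:
  "g \<in> carrier G \<Longrightarrow> x \<in> carrier G \<Longrightarrow> conj_by g x \<in> carrier G"
  by (simp add: conj_by_def)

lemma conj_by_mult:
  assumes "g \<in> carrier G" "x \<in> carrier G" "y \<in> carrier G"
  shows "conj_by g (x \<otimes> y) = conj_by g x \<otimes> conj_by g y"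
  using assms by (simp add: conj_by_def m_assoc)

lemma conj_by_conj_by:
  assumes "g \<in> carrier G" "h \<in> carrier G" "x \<in> carrier G"
  shows "conj_by g (conj_by h x) = conj_by (g \<otimes> h) x"
  using assms by (simp add: conj_by_def m_assoc inv_mult_group)

lemma conj_by_hom: "g \<in> carrier G \<Longrightarrow> conj_by g \<in> hom G G"
  by (auto simp: hom_def conj_by_mult)

lemma conj_by_int_pow:
  assumes "g \<in> carrier G" "x \<in> carrier G"
  shows "conj_by g (x [^] (n::int)) = conj_by g x [^] n"
  using hom_int_pow [OF conj_by_hom _ is_group is_group] assms by simp

lemma conj_by_eq_iff:
  assumes "g \<in> carrier G" "x \<in> carrier G" "y \<in> carrier G"
  shows "conj_by g x = y \<longleftrightarrow> g \<otimes> x = y \<otimes> g"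
  using assms by (metis conj_by_def inv_solve_right m_closed)

lemma int_pow_mult_left:
  assumes "x \<in> carrier G" "y \<in> carrier G"
  shows "x [^] (i::int) \<otimes> (x [^] (j::int) \<otimes> y) = x [^] (i + j) \<otimes> y"
  using assms by (simp add: m_assoc int_pow_mult)

lemma int_pow_cong:
  assumes "x \<in> carrier G" "x [^] (N::int) = \<one>" "N dvd i - j"
  shows "x [^] i = x [^] j"
proof -
  obtain k where "i = j + N * k"
    using assms(3) by (metis dvdE add_diff_cancel_left' diff_add_cancel add.commute)
  then show ?thesis
    using assms by (simp add: int_pow_mult int_pow_pow [symmetric])
qed

lemma int_pow_commute:
  assumes "x \<in> carrier G" "y \<in> carrier G" "x \<otimes> y = y \<otimes> x"
  shows "x [^] (n::int) \<otimes> y = y \<otimes> x [^] n"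
proof -
  have "conj_by y x = x"
    using assms by (simp add: conj_by_eq_iff)
  then have "conj_by y (x [^] n) = x [^] n"
    using assms by (simp add: conj_by_int_pow)
  then show ?thesis
    using assms by (simp add: conj_by_eq_iff)
qed

end

section \<open>The rotation relations\<close>

text \<open>In the application \<open>p = 2 ^ (\<beta> - 5)\<close>, so that \<open>32 * p\<close>, \<open>16 * p\<close> and \<open>8 * p\<close> are
  the powers of two occurring in the relations. The argument is uniform in \<open>p\<close>.\<close>

locale rotation_gens = group +
  fixes a b c and p e1 :: int
  assumes gens [simp]: "a \<in> carrier G" "b \<in> carrier G" "c \<in> carrier G"
    and ab_sq: "(a \<otimes> b) \<otimes> (a \<otimes> b) = \<one>"
    and bc_sq: "(b \<otimes> c) \<otimes> (b \<otimes> c) = \<one>"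
    and abc_sq: "(a \<otimes> b \<otimes> c) \<otimes> (a \<otimes> b \<otimes> c) = \<one>"
    and b_pow: "b [^] (32 * p) = \<one>"
    and ba_rel: "b \<otimes> inv a = a \<otimes> b [^] (3 - e1 * (16 * p))"
begin

text \<open>Reduces a comparison of powers of \<open>b\<close> to an identity between exponents. The
  quotient \<open>k\<close> is given explicitly at each use, so that only polynomial arithmetic in
  the integer parameters remains.\<close>

lemma b_pow_cong:
  "i = j + 32 * p * k \<Longrightarrow> b [^] i = b [^] j"
  by (rule int_pow_cong [OF gens(2) b_pow]) simp

section \<open>Conjugation by \<open>inv a\<close>, common to both cases\<close>

lemma inv_a: "inv a = b \<otimes> a \<otimes> b"
proof -
  have "a \<otimes> (b \<otimes> a \<otimes> b) = \<one>"
    using ab_sq by (simp add: m_assoc)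
  then have "inv (b \<otimes> a \<otimes> b) = a"
    by (rule inv_equality) simp_all
  then have "inv a = inv (inv (b \<otimes> a \<otimes> b))"
    by simp
  then show ?thesis
    by (simp only: inv_inv m_closed gens)
qed

lemma inv_c: "inv c = b \<otimes> c \<otimes> b"
  using bc_sq by (metis gens(2,3) inv_equality m_assoc m_closed)

text \<open>With \<open>inv a = b * a * b\<close>, both sides of \<open>ba_rel\<close> end in a
  power of \<open>b\<close>; cancelling one \<open>b\<close> leaves a relation between
  \<open>a\<close> and \<open>b ^ 2\<close>.\<close>

lemma conj_inv_a_b2: "conj_by (inv a) (b [^] (2::int)) = b [^] (2 - e1 * (16 * p))"
proof -
  have "b \<otimes> (b \<otimes> a \<otimes> b) = a \<otimes> b [^] (3 - e1 * (16 * p))"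
    using ba_rel by (simp add: inv_a)
  also have "b [^] (3 - e1 * (16 * p)) = b [^] (2 - e1 * (16 * p)) \<otimes> b"
    using int_pow_mult [of b "2 - e1 * (16 * p)" 1] by simp
  finally have "b [^] (2::int) \<otimes> a = a \<otimes> b [^] (2 - e1 * (16 * p))"
    using int_pow_mult [of b 1 1] by (simp add: m_assoc [symmetric])
  then show ?thesis
    by (simp add: conj_by_def m_assoc inv_solve_left)
qed

text \<open>As \<open>a * b\<close> and \<open>a * b * c\<close> are their own inverses,
  \<open>a * b\<close> inverts \<open>c\<close> by conjugation. Hence the conjugate is
  \<open>b * inv c * inv b\<close>, into which \<open>inv c = b * c * b\<close> is
  substituted.\<close>

lemma conj_inv_a_c: "conj_by (inv a) c = b [^] (2::int) \<otimes> c"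
proof -
  have "a \<otimes> b \<otimes> c = inv (a \<otimes> b \<otimes> c)"
    using abc_sq inv_equality by auto
  moreover have "a \<otimes> b = inv (a \<otimes> b)"
    using ab_sq inv_equality by auto
  ultimately have "inv b \<otimes> inv a \<otimes> c = inv c \<otimes> inv b \<otimes> inv a"
    by (metis gens inv_closed inv_mult_group m_assoc m_closed)
  then have "inv a \<otimes> c = b \<otimes> inv c \<otimes> inv b \<otimes> inv a"
    by (metis gens inv_cancel_left(2) inv_closed m_assoc m_closed)
  then have "inv a \<otimes> c \<otimes> a = b \<otimes> (b \<otimes> c \<otimes> b) \<otimes> inv b"
    by (simp add: m_assoc inv_c)
  then show ?thesis
    using int_pow_mult [of b 1 1] by (simp add: conj_by_def m_assoc)
qed

lemma conj_by_b_pow: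
  assumes "g \<in> carrier G" "conj_by g (b [^] (m::int)) = b [^] (j::int)"
  shows "conj_by g (b [^] (m * n)) = b [^] (j * n)"
  using assms by (simp add: int_pow_pow [symmetric] conj_by_int_pow)

section \<open>Case (a): \<open>c\<close> has order dividing 8\<close>

lemma half_power_trivial_of_c_pow_8:
  assumes c8: "c [^] (8::int) = \<one>" and e2: "odd e2"
    and rel: "b \<otimes> c [^] (2::int) = c [^] (2::int) \<otimes> b [^] (1 + e2 * (8 * p))"
  shows "b [^] (16 * p) = \<one>"
proof -
  define d where "d = e2 * (8 * p)"
  obtain f where f: "e2 = 2 * f + 1"
    using e2 by (elim oddE)
  have c4_sym: "c [^] (-4::int) = c [^] (4::int)"
    by (rule int_pow_cong [OF gens(3) c8]) simp
  \<comment> \<open>On powers of \<open>b\<close>, conjugation by \<open>c ^ -2\<close> multiplies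
    exponents by \<open>1 + d\<close>. Both \<open>4 * d\<close> and \<open>d * d\<close> vanish
    modulo \<open>32 * p\<close>, which drives the reductions below.\<close>
  have conj_c2: "conj_by (c [^] (-2::int)) b = b [^] (1 + d)"
    using rel int_pow_neg [of c 2] by (simp add: conj_by_def m_assoc inv_solve_left d_def)
  have conj_c2n: "conj_by (c [^] (-2::int)) (b [^] n) = b [^] ((1 + d) * n)" for n :: int
    by (simp add: int_pow_pow [symmetric] conj_by_int_pow conj_c2)
  have conj_c4n: "conj_by (c [^] (-4::int)) (b [^] n) = b [^] ((1 + d) * (1 + d) * n)" for n :: int
    using conj_by_conj_by [of "c [^] (-2::int)" "c [^] (-2::int)" "b [^] n"]
    by (simp add: conj_c2n int_pow_mult [symmetric] mult.assoc)
  have inv_c_b: "inv c \<otimes> b \<otimes> c = c [^] (-2::int) \<otimes> inv b"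
  proof -
    have "b \<otimes> c = inv (b \<otimes> c)"
      using bc_sq inv_equality by auto
    then have "inv c \<otimes> b \<otimes> c = inv c \<otimes> (inv c \<otimes> inv b)"
      by (simp add: m_assoc inv_mult_group)
    then show ?thesis
      using int_pow_neg [of c 2] int_pow_mult [of "inv c" 1 1] by (simp add: int_pow_inv m_assoc)
  qed
  \<comment> \<open>The conjugate of \<open>b\<close> is \<open>c ^ -2 * inv b\<close>. In its
    square both factors \<open>c ^ -2\<close> are moved to the right; one \<open>inv b\<close> is
    passed by \<open>c ^ -2\<close>, the other by \<open>c ^ -4\<close>, whence the exponents
    \<open>1 + d\<close> and \<open>(1 + d) * (1 + d)\<close>.\<close>
  have conj_b2: "conj_by (inv c) (b [^] (2::int)) = b [^] (- 2 - 3 * d) \<otimes> c [^] (4::int)"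
  proof -
    have "conj_by (inv c) (b [^] (2::int)) = conj_by (inv c) b \<otimes> conj_by (inv c) b"
      using int_pow_mult [of b 1 1] conj_by_mult [of "inv c" b b] by simp
    also have "conj_by (inv c) b = c [^] (-2::int) \<otimes> b [^] (-1::int)"
      using inv_c_b int_pow_neg [of b 1] by (simp add: conj_by_def)
    also have "c [^] (-2::int) \<otimes> b [^] (-1::int) \<otimes> (c [^] (-2::int) \<otimes> b [^] (-1::int))
        = conj_by (c [^] (-2::int)) (b [^] (-1::int)) \<otimes> (c [^] (-4::int) \<otimes> b [^] (-1::int))"
      by (simp add: conj_by_def m_assoc int_pow_neg [symmetric] int_pow_mult_left)
    also have "c [^] (-4::int) \<otimes> b [^] (-1::int)
        = conj_by (c [^] (-4::int)) (b [^] (-1::int)) \<otimes> c [^] (-4::int)"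
      by (simp add: conj_by_def m_assoc)
    also have "conj_by (c [^] (-2::int)) (b [^] (-1::int)) \<otimes> (conj_by (c [^] (-4::int)) (b [^] (-1::int)) \<otimes> c [^] (-4::int))
       = b [^] (- (1 + d) - (1 + d) * (1 + d)) \<otimes> c [^] (-4::int)"
      by (simp add: conj_c2n conj_c4n int_pow_mult_left)
    also have "b [^] (- (1 + d) - (1 + d) * (1 + d)) = b [^] (- 2 - 3 * d)"
      by (rule b_pow_cong [of _ _ "- e2 * e2 * 2 * p"]) (simp add: d_def algebra_simps)
    finally show ?thesis
      by (simp add: c4_sym)
  qed
  have c4_b2: "conj_by (c [^] (4::int)) (b [^] (2 * n)) = b [^] (2 * n)" for n :: int
    unfolding c4_sym [symmetric] conj_c4n
    by (rule b_pow_cong [of _ _ "e2 * n + e2 * e2 * 4 * p * n"]) (simp add: d_def algebra_simps)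
  \<comment> \<open>Squaring \<open>conj_b2\<close>: the two factors \<open>c ^ 4\<close> meet
    because \<open>c ^ 4\<close> commutes with even powers of \<open>b\<close>, and their product is
    \<open>c ^ 8 = 1\<close>.\<close>
  have conj_b4: "conj_by (inv c) (b [^] (4::int)) = b [^] (- 4 - 6 * d)"
  proof -
    have "conj_by (inv c) (b [^] (4::int))
        = b [^] (- 2 - 3 * d) \<otimes> c [^] (4::int) \<otimes> (b [^] (- 2 - 3 * d) \<otimes> c [^] (4::int))"
      using conj_by_mult [of "inv c" "b [^] (2::int)" "b [^] (2::int)"]
      by (simp add: conj_b2 int_pow_mult [symmetric])
    also have "\<dots> = b [^] (- 2 - 3 * d) \<otimes> conj_by (c [^] (4::int)) (b [^] (- 2 - 3 * d))
        \<otimes> c [^] (8::int)"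
      by (simp add: conj_by_def m_assoc int_pow_neg [symmetric] int_pow_mult [symmetric])
    also have "conj_by (c [^] (4::int)) (b [^] (- 2 - 3 * d)) = b [^] (- 2 - 3 * d)"
      using c4_b2 [of "- 1 - 3 * e2 * (4 * p)"] by (simp add: d_def algebra_simps)
    finally show ?thesis
      by (simp add: c8 int_pow_mult [symmetric])
  qed
  \<comment> \<open>The correction term of \<open>conj_inv_a_b2\<close> is a power of
    \<open>b ^ 4\<close>, so \<open>conj_b4\<close> applies and yields its inverse; the two agree
    because its square is trivial.\<close>
  have conj_e: "conj_by (inv c) (b [^] (e1 * (16 * p))) = b [^] (e1 * (16 * p))"
  proof -
    have "conj_by (inv c) (b [^] (4 * (e1 * (4 * p)))) = b [^] ((- 4 - 6 * d) * (e1 * (4 * p)))"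
      by (rule conj_by_b_pow) (simp_all add: conj_b4)
    also have "\<dots> = b [^] (e1 * (16 * p))"
      by (rule b_pow_cong [of _ _ "- e1 - 6 * e1 * e2 * p"]) (simp add: d_def algebra_simps)
    finally show ?thesis
      by (simp add: mult_ac)
  qed
  \<comment> \<open>First value of this conjugate, by conjugating both sides of
    \<open>conj_b2\<close> with \<open>inv a\<close>. On the left
    \<open>inv a * inv c = inv (b ^ 2 * c) * inv a\<close> moves the conjugation onto
    \<open>b ^ 2\<close>. Both sides acquire the factor \<open>b ^ (e1 * (16 * p))\<close>, which
    cancels.\<close>
  have "conj_by (inv a) (c [^] (4::int)) = c [^] (4::int)"
  proof -
    have "conj_by (inv a) (conj_by (inv c) (b [^] (2::int)))
        = conj_by (inv (b [^] (2::int) \<otimes> c)) (b [^] (2 - e1 * (16 * p)))"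
    proof -
      have "inv a \<otimes> inv c = inv (b [^] (2::int) \<otimes> c) \<otimes> inv a"
        using conj_inv_a_c
        by (metis conj_by_def gens(1,3) inv_closed inv_inv inv_mult_group m_assoc m_closed inv_cancel_left(2))
      then show ?thesis
        by (simp add: conj_by_conj_by conj_inv_a_b2 [symmetric])
    qed
    also have "\<dots> = conj_by (inv c) (conj_by (inv (b [^] (2::int))) (b [^] (2 - e1 * (16 * p))))"
      by (simp add: conj_by_conj_by inv_mult_group)
    also have "conj_by (inv (b [^] (2::int))) (b [^] (2 - e1 * (16 * p))) = b [^] (2 - e1 * (16 * p))"
      by (simp add: conj_by_def int_pow_neg [symmetric] int_pow_mult [symmetric])
    also have "\<dots> = b [^] (2::int) \<otimes> b [^] (e1 * (16 * p))"
      unfolding int_pow_mult [OF gens(2), symmetric]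
      by (rule b_pow_cong [of _ _ "- e1"]) simp
    also have "conj_by (inv c) \<dots> = b [^] (- 2 - 3 * d) \<otimes> c [^] (4::int) \<otimes> b [^] (e1 * (16 * p))"
      by (simp add: conj_by_mult conj_b2 conj_e)
    also have "c [^] (4::int) \<otimes> b [^] (e1 * (16 * p)) = b [^] (e1 * (16 * p)) \<otimes> c [^] (4::int)"
      using c4_b2 [of "e1 * (8 * p)"] by (simp add: conj_by_eq_iff mult_ac)
    then have "b [^] (- 2 - 3 * d) \<otimes> c [^] (4::int) \<otimes> b [^] (e1 * (16 * p))
        = b [^] (- 2 - 3 * d + e1 * (16 * p)) \<otimes> c [^] (4::int)"
      by (simp add: m_assoc int_pow_mult)
    finally have "conj_by (inv a) (b [^] (- 2 - 3 * d)) \<otimes> conj_by (inv a) (c [^] (4::int))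
        = b [^] (- 2 - 3 * d + e1 * (16 * p)) \<otimes> c [^] (4::int)"
      by (simp add: conj_b2 conj_by_mult)
    moreover have "conj_by (inv a) (b [^] (- 2 - 3 * d)) = b [^] (- 2 - 3 * d + e1 * (16 * p))"
    proof -
      have "conj_by (inv a) (b [^] (2 * (- 1 - 12 * e2 * p))) = b [^] ((2 - e1 * (16 * p)) * (- 1 - 12 * e2 * p))"
        by (rule conj_by_b_pow) (simp_all add: conj_inv_a_b2)
      also have "\<dots> = b [^] (- 2 - 3 * d + e1 * (16 * p))"
        by (rule b_pow_cong [of _ _ "e1 * 6 * e2 * p"]) (simp add: d_def algebra_simps)
      finally show ?thesis
        by (simp add: d_def algebra_simps)
    qed
    ultimately show ?thesis
      by simp
  qed
  \<comment> \<open>Second value, by computing the fourth power of \<open>b ^ 2 * c\<close>. Its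
    square collapses to \<open>c ^ -2 * b ^ (- d)\<close>, whose factors commute because
    \<open>d * d\<close> vanishes modulo \<open>32 * p\<close>.\<close>
  moreover have "conj_by (inv a) (c [^] (4::int)) = c [^] (4::int) \<otimes> b [^] (16 * p)"
  proof -
    have sq: "conj_by (inv a) (c [^] (2::int)) = c [^] (-2::int) \<otimes> b [^] (- d)"
    proof -
      have "conj_by (inv a) (c [^] (2::int)) = b [^] (2::int) \<otimes> c \<otimes> (b [^] (2::int) \<otimes> c)"
        using int_pow_mult [of c 1 1] conj_by_mult [of "inv a" c c] by (simp add: conj_inv_a_c)
      also have "\<dots> = b [^] (2::int) \<otimes> (c [^] (2::int) \<otimes> conj_by (inv c) (b [^] (2::int)))"
        using int_pow_mult [of c 1 1] by (simp add: conj_by_def m_assoc)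
      also have "\<dots> = b [^] (2::int) \<otimes> c [^] (2::int) \<otimes> (b [^] (- 2 - 3 * d) \<otimes> c [^] (4::int))"
        by (simp add: conj_b2 m_assoc)
      also have "b [^] (2::int) \<otimes> c [^] (2::int) = c [^] (2::int) \<otimes> b [^] ((1 + d) * 2)"
        using conj_c2n [of 2] int_pow_neg [of c 2] by (simp add: conj_by_def m_assoc inv_solve_left')
      also have "c [^] (2::int) \<otimes> b [^] ((1 + d) * 2) \<otimes> (b [^] (- 2 - 3 * d) \<otimes> c [^] (4::int))
          = c [^] (2::int) \<otimes> (b [^] (- d) \<otimes> c [^] (4::int))"
        by (simp add: m_assoc int_pow_mult_left algebra_simps)
      also have "b [^] (- d) \<otimes> c [^] (4::int) = c [^] (4::int) \<otimes> b [^] (- d)"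
        using c4_b2 [of "- (e2 * (4 * p))"] by (simp add: conj_by_eq_iff d_def mult_ac)
      also have "c [^] (4::int) = c [^] (-4::int)"
        by (simp add: c4_sym)
      finally show ?thesis
        by (simp add: int_pow_mult_left)
    qed
    have "conj_by (inv a) (c [^] (4::int))
        = c [^] (-2::int) \<otimes> b [^] (- d) \<otimes> (c [^] (-2::int) \<otimes> b [^] (- d))"
      using int_pow_mult [of c 2 2] conj_by_mult [of "inv a" "c [^] (2::int)" "c [^] (2::int)"]
      by (simp add: sq)
    also have "c [^] (-2::int) \<otimes> b [^] (- d) = b [^] (- d) \<otimes> c [^] (-2::int)"
    proof -
      have "b [^] ((1 + d) * - d) = b [^] (- d)"
        by (rule b_pow_cong [of _ _ "- 2 * e2 * e2 * p"]) (simp add: d_def algebra_simps)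
      then show ?thesis
        using conj_c2n [of "- d"] by (simp add: conj_by_eq_iff)
    qed
    also have "b [^] (- d) \<otimes> c [^] (-2::int) \<otimes> (b [^] (- d) \<otimes> c [^] (-2::int))
       = b [^] (- d) \<otimes> (c [^] (-2::int) \<otimes> b [^] (- d)) \<otimes> c [^] (-2::int)"
      by (simp add: m_assoc)
    also have "c [^] (-2::int) \<otimes> b [^] (- d) = b [^] (- d) \<otimes> c [^] (-2::int)"
      by fact
    also have "b [^] (- d) \<otimes> (b [^] (- d) \<otimes> c [^] (-2::int)) \<otimes> c [^] (-2::int)
        = b [^] (- 2 * d) \<otimes> c [^] (-4::int)"
      by (simp add: m_assoc int_pow_mult_left int_pow_mult [symmetric])
    \<comment> \<open>Here \<open>e2\<close> being odd matters: \<open>2 * d\<close> is an odd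
      multiple of \<open>16 * p\<close>.\<close>
    also have "b [^] (- 2 * d) = b [^] (16 * p)"
      by (rule b_pow_cong [of _ _ "- 1 - f"]) (simp add: d_def f algebra_simps)
    also have "b [^] (16 * p) \<otimes> c [^] (-4::int) = c [^] (4::int) \<otimes> b [^] (16 * p)"
      using c4_b2 [of "8 * p"] by (simp add: conj_by_eq_iff c4_sym)
    finally show ?thesis .
  qed
  ultimately show ?thesis
    by simp
qed

section \<open>Case (b): \<open>c\<close> has order dividing \<open>16 * p\<close>\<close>

lemma half_power_trivial_of_c_pow_16p:
  assumes c16: "c [^] (16 * p) = \<one>"
    and rel1: "inv c \<otimes> b = b [^] (3 + e2 * (8 * p)) \<otimes> c [^] (1 - 8 * p)"
    and rel2: "c \<otimes> inv b = b [^] (-3 + e2 * (8 * p)) \<otimes> c [^] (-1 + 8 * p)"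
  shows "b [^] (16 * p) = \<one>"
proof -
  \<comment> \<open>With this \<open>k\<close> the term \<open>e2 * (8 * p)\<close> is
    \<open>4 * k\<close>, and \<open>16 * k\<close> and \<open>8 * k * k\<close> are multiples of
    \<open>32 * p\<close>.\<close>
  define k where "k = 2 * p * e2"
  define y where "y = c [^] (8 * p)"
  have y [simp]: "y \<in> carrier G"
    by (simp add: y_def)
  have yy: "y \<otimes> y = \<one>"
    by (simp add: y_def int_pow_mult [symmetric] c16)
  then have inv_y: "inv y = y"
    using inv_equality by auto
  have y_c: "c [^] n \<otimes> y = y \<otimes> c [^] n" for n :: int
    by (simp add: y_def int_pow_mult [symmetric] add.commute)
  \<comment> \<open>\<open>rel1\<close> and the inverse of \<open>rel2\<close>, with
    \<open>inv c\<close> replaced by \<open>b * c * b\<close> and one \<open>b\<close> cancelled,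
    give two formulas for conjugation by \<open>c\<close>: this one and
    \<open>conj_b2'\<close>.\<close>
  have conj_b2: "conj_by c (b [^] (2::int)) = b [^] (2 + 4 * k) \<otimes> y"
  proof -
    have "c [^] (1 - 8 * p) = c \<otimes> inv y"
      using int_pow_mult [of c 1 "- (8 * p)"] by (simp add: y_def int_pow_neg)
    then have "b \<otimes> (c \<otimes> b [^] (2::int)) = b [^] (3 + 4 * k) \<otimes> (c \<otimes> y)"
      using rel1 int_pow_mult [of b 1 1] by (simp add: inv_c inv_y m_assoc k_def mult_ac)
    also have "b [^] (3 + 4 * k) = b \<otimes> b [^] (2 + 4 * k)"
      using int_pow_mult [of b 1 "2 + 4 * k"] by (simp add: add.commute)
    finally have "c \<otimes> b [^] (2::int) = b [^] (2 + 4 * k) \<otimes> y \<otimes> c"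
      using y_c [of 1] by (simp add: m_assoc)
    then show ?thesis
      by (simp add: conj_by_eq_iff)
  qed
  have conj_b2': "conj_by c (b [^] (2 - 4 * k)) = y \<otimes> b [^] (2::int)"
  proof -
    have "inv (c \<otimes> inv b) = inv (b [^] (-3 + 4 * k) \<otimes> c [^] (-1 + 8 * p))"
      using rel2 by (simp add: k_def mult_ac)
    also have "\<dots> = c [^] (1 - 8 * p) \<otimes> b [^] (3 - 4 * k)"
      by (simp add: inv_mult_group int_pow_neg [symmetric])
    also have "c [^] (1 - 8 * p) = y \<otimes> c"
      using int_pow_mult [of c "- (8 * p)" 1] by (simp add: int_pow_neg inv_y flip: y_def)
    also have "b [^] (3 - 4 * k) = b [^] (2 - 4 * k) \<otimes> b"
      using int_pow_mult [of b "2 - 4 * k" 1] by simp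
    also have "inv (c \<otimes> inv b) = b [^] (2::int) \<otimes> c \<otimes> b"
      using int_pow_mult [of b 1 1] by (simp add: inv_mult_group inv_c m_assoc)
    finally have "b [^] (2::int) \<otimes> c = y \<otimes> c \<otimes> b [^] (2 - 4 * k)"
      by (simp add: m_assoc [symmetric])
    then have "y \<otimes> b [^] (2::int) \<otimes> c = y \<otimes> y \<otimes> (c \<otimes> b [^] (2 - 4 * k))"
      by (simp add: m_assoc)
    then show ?thesis
      by (simp add: conj_by_eq_iff yy)
  qed
  define w where "w = conj_by c (b [^] (4::int))"
  have w [simp]: "w \<in> carrier G"
    by (simp add: w_def)
  have w_eq: "w = b [^] (2 + 4 * k) \<otimes> (y \<otimes> (b [^] (2 + 4 * k) \<otimes> y))"
    using conj_by_mult [of c "b [^] (2::int)" "b [^] (2::int)"]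
    by (simp add: w_def conj_b2 int_pow_mult [symmetric] m_assoc)
  \<comment> \<open>Since \<open>b ^ (4 * k)\<close> is the quotient of \<open>b ^ 2\<close> by
    \<open>b ^ (2 - 4 * k)\<close>, the two formulas determine \<open>w ^ k\<close>. Comparison with
    \<open>w_eq\<close> eliminates \<open>y\<close> and leaves
    \<open>w ^ (1 - k) = b ^ (4 + 4 * k)\<close>. Modulo \<open>8 * p\<close> the inverse of
    \<open>1 - k\<close> is \<open>(1 + k) * (1 + k * k)\<close>, the product being
    \<open>1 - k ^ 4\<close>.\<close>
  have w_b4: "w = b [^] (4 + 8 * k)"
  proof -
    have "w [^] k = conj_by c (inv (b [^] (2 - 4 * k)) \<otimes> b [^] (2::int))"
      by (simp add: w_def conj_by_int_pow [symmetric] int_pow_pow int_pow_neg [symmetric]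
          int_pow_mult [symmetric])
    also have "\<dots> = conj_by c ((b [^] (2 - 4 * k)) [^] (-1::int)) \<otimes> conj_by c (b [^] (2::int))"
      by (simp add: conj_by_mult int_pow_neg)
    also have "\<dots> = inv (y \<otimes> b [^] (2::int)) \<otimes> (b [^] (2 + 4 * k) \<otimes> y)"
      using conj_by_int_pow [of c "b [^] (2 - 4 * k)" "-1"]
      by (simp add: conj_b2 conj_b2' int_pow_neg)
    finally have wk: "w [^] k = b [^] (-2::int) \<otimes> (y \<otimes> (b [^] (2 + 4 * k) \<otimes> y))"
      by (simp add: inv_mult_group inv_y int_pow_neg m_assoc)
    then have "w = b [^] (4 + 4 * k) \<otimes> w [^] k"
      by (simp add: w_eq int_pow_mult_left)
    then have "w [^] (1 - k) = b [^] (4 + 4 * k)"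
      using int_pow_mult [of w 1 "- k"] by (simp add: int_pow_neg inv_solve_right')
    then have "w [^] ((1 - k) * ((1 + k) * (1 + k * k))) = b [^] ((4 + 4 * k) * ((1 + k) * (1 + k * k)))"
      by (simp only: int_pow_pow [symmetric] w gens)
    moreover have "w [^] ((1 - k) * ((1 + k) * (1 + k * k))) = w [^] (1::int)"
    proof (rule int_pow_cong [OF w])
      show "w [^] (8 * p) = \<one>"
        using conj_by_int_pow [of c "b [^] (4::int)" "8 * p"] b_pow
        by (simp add: w_def int_pow_pow conj_by_def)
      have "(1 - k) * ((1 + k) * (1 + k * k)) - 1 = 8 * p * (- 2 * p * p * p * e2 * e2 * e2 * e2)"
        by (simp add: k_def algebra_simps)
      then show "8 * p dvd (1 - k) * ((1 + k) * (1 + k * k)) - 1"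
        by (metis dvd_triv_left)
    qed
    moreover have "b [^] ((4 + 4 * k) * ((1 + k) * (1 + k * k))) = b [^] (4 + 8 * k)"
      by (rule b_pow_cong [of _ _ "p * e2 * e2 + 2 * p * p * e2 * e2 * e2 + 2 * p * p * p * e2 * e2 * e2 * e2"])
        (simp add: k_def algebra_simps)
    ultimately show ?thesis
      by simp
  qed
  \<comment> \<open>\<open>w_eq\<close> and \<open>w_b4\<close> together say that \<open>y\<close>
    commutes with \<open>b ^ (2 + 4 * k)\<close>. This element generates the same subgroup as
    \<open>b ^ 2\<close>, because \<open>(2 + 4 * k) * (1 - 2 * k)\<close> is 2 modulo
    \<open>32 * p\<close>.\<close>
  have y_b: "conj_by y (b [^] (2 * n)) = b [^] (2 * n)" for n :: int
  proof -
    have "b [^] (4 + 8 * k) = b [^] (2 + 4 * k) \<otimes> b [^] (2 + 4 * k)"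
      by (simp add: int_pow_mult [symmetric])
    then have "y \<otimes> (b [^] (2 + 4 * k) \<otimes> y) = b [^] (2 + 4 * k)"
      using w_eq w_b4 by simp
    then have "conj_by y (b [^] (2 + 4 * k)) = b [^] (2 + 4 * k)"
      by (simp add: conj_by_def inv_y m_assoc)
    then have "conj_by y (b [^] ((2 + 4 * k) * ((1 - 2 * k) * n)))
        = b [^] ((2 + 4 * k) * ((1 - 2 * k) * n))"
      by (intro conj_by_b_pow) simp_all
    moreover have "b [^] ((2 + 4 * k) * ((1 - 2 * k) * n)) = b [^] (2 * n)"
      by (rule b_pow_cong [of _ _ "- p * e2 * e2 * n"]) (simp add: k_def algebra_simps)
    ultimately show ?thesis
      by simp
  qed
  have conj_b4: "conj_by c (b [^] (4 * n)) = b [^] ((4 + 8 * k) * n)" for n :: int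
    by (rule conj_by_b_pow) (simp_all add: w_b4 [symmetric] w_def)
  have conj_b8: "conj_by c (b [^] (8 * n)) = b [^] (8 * n)" for n :: int
  proof -
    have "conj_by c (b [^] (4 * (2 * n))) = b [^] ((4 + 8 * k) * (2 * n))"
      by (rule conj_b4)
    also have "\<dots> = b [^] (8 * n)"
      by (rule b_pow_cong [of _ _ "e2 * n"]) (simp add: k_def algebra_simps)
    finally show ?thesis
      by simp
  qed
  have conj_c2_b4: "conj_by (c [^] (2::int)) (b [^] (4 * n)) = b [^] (4 * n)" for n :: int
  proof -
    have "conj_by (c [^] (2::int)) (b [^] (4 * n)) = conj_by c (conj_by c (b [^] (4 * n)))"
      using int_pow_mult [of c 1 1] by (simp add: conj_by_conj_by)
    also have "\<dots> = b [^] ((4 + 8 * k) * ((1 + 2 * k) * n))"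
    proof -
      have "(4 + 8 * k) * n = 4 * ((1 + 2 * k) * n)"
        by (simp add: algebra_simps)
      then show ?thesis
        by (simp only: conj_b4)
    qed
    also have "\<dots> = b [^] (4 * n)"
      by (rule b_pow_cong [of _ _ "e2 * n + 2 * p * e2 * e2 * n"]) (simp add: k_def algebra_simps)
    finally show ?thesis .
  qed
  \<comment> \<open>Powers of \<open>b ^ 2 * c\<close>, computed directly. The square contains one
    \<open>y\<close>, which disappears in the fourth power; there the parts in \<open>b\<close> and
    \<open>c\<close> commute. Raising to the power \<open>2 * p\<close> turns \<open>c ^ 4\<close>
    into \<open>y\<close> and \<open>b ^ (8 + 8 * k)\<close> into
    \<open>b ^ (16 * p)\<close>.\<close>
  have conj_a_y: "conj_by (inv a) y = b [^] (16 * p) \<otimes> y"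
  proof -
    have "conj_by (inv a) (c [^] (2::int)) = b [^] (2::int) \<otimes> c \<otimes> (b [^] (2::int) \<otimes> c)"
      using int_pow_mult [of c 1 1] conj_by_mult [of "inv a" c c] by (simp add: conj_inv_a_c)
    also have "\<dots> = b [^] (2::int) \<otimes> (conj_by c (b [^] (2::int)) \<otimes> c [^] (2::int))"
      using int_pow_mult [of c 1 1] by (simp add: conj_by_def m_assoc)
    also have "\<dots> = b [^] (4 * (1 + k)) \<otimes> (y \<otimes> c [^] (2::int))"
      by (simp add: conj_b2 m_assoc int_pow_mult_left algebra_simps)
    finally have sq: "conj_by (inv a) (c [^] (2::int)) = b [^] (4 * (1 + k)) \<otimes> (y \<otimes> c [^] (2::int))" .
    have yc_b4: "y \<otimes> c [^] (2::int) \<otimes> b [^] (4 * n) = b [^] (4 * n) \<otimes> (y \<otimes> c [^] (2::int))" for n :: int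
    proof -
      have "conj_by (y \<otimes> c [^] (2::int)) (b [^] (4 * n)) = b [^] (4 * n)"
        using y_b [of "2 * n"] by (simp add: conj_by_conj_by [symmetric] conj_c2_b4)
      then show ?thesis
        by (simp add: conj_by_eq_iff)
    qed
    have "conj_by (inv a) (c [^] (4::int)) = b [^] (4 * (1 + k)) \<otimes> (y \<otimes> c [^] (2::int))
        \<otimes> (b [^] (4 * (1 + k)) \<otimes> (y \<otimes> c [^] (2::int)))"
      using int_pow_mult [of c 2 2] conj_by_mult [of "inv a" "c [^] (2::int)" "c [^] (2::int)"]
      by (simp add: sq)
    also have "\<dots> = b [^] (4 * (1 + k)) \<otimes> (y \<otimes> c [^] (2::int) \<otimes> b [^] (4 * (1 + k)))
         \<otimes> (y \<otimes> c [^] (2::int))"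
      by (simp only: m_assoc m_closed int_pow_closed gens y)
    also have "\<dots> = b [^] (4 * (1 + k)) \<otimes> (b [^] (4 * (1 + k)) \<otimes> (y \<otimes> c [^] (2::int)))
         \<otimes> (y \<otimes> c [^] (2::int))"
      by (simp only: yc_b4)
    also have "\<dots> = b [^] (8 + 8 * k) \<otimes> (y \<otimes> (c [^] (2::int) \<otimes> y) \<otimes> c [^] (2::int))"
      by (simp add: m_assoc int_pow_mult_left)
    also have "y \<otimes> (c [^] (2::int) \<otimes> y) \<otimes> c [^] (2::int) = y \<otimes> y \<otimes> (c [^] (2::int) \<otimes> c [^] (2::int))"
      by (simp only: y_c m_assoc m_closed int_pow_closed gens y)
    also have "\<dots> = c [^] (4::int)"
      by (simp add: yy int_pow_mult [symmetric])
    finally have four: "conj_by (inv a) (c [^] (4::int)) = b [^] (8 + 8 * k) \<otimes> c [^] (4::int)" .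
    have comm: "b [^] (8 + 8 * k) \<otimes> c [^] (4::int) = c [^] (4::int) \<otimes> b [^] (8 + 8 * k)"
    proof -
      have "conj_by c (b [^] (8 + 8 * k)) = b [^] (8 + 8 * k)"
        using conj_b8 [of "1 + k"] by (simp add: algebra_simps)
      then show ?thesis
        using int_pow_commute [of c "b [^] (8 + 8 * k)" 4] by (simp add: conj_by_eq_iff)
    qed
    have "conj_by (inv a) y = conj_by (inv a) (c [^] (4::int)) [^] (2 * p)"
      by (simp add: conj_by_int_pow [symmetric] y_def int_pow_pow)
    also have "\<dots> = b [^] ((8 + 8 * k) * (2 * p)) \<otimes> y"
      by (simp add: four int_pow_mult_distrib [OF comm] int_pow_pow y_def)
    also have "b [^] ((8 + 8 * k) * (2 * p)) = b [^] (16 * p)"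
      by (rule b_pow_cong [of _ _ "p * e2"]) (simp add: k_def algebra_simps)
    finally show ?thesis .
  qed
  \<comment> \<open>The other evaluation: both sides of \<open>conj_b2\<close> are conjugated by
    \<open>inv a\<close>, using \<open>inv a * c = b ^ 2 * c * inv a\<close>. The power of
    \<open>b\<close> changes equally on both sides, so \<open>y\<close> would be fixed, and
    \<open>conj_a_y\<close> then forces the half power to be trivial.\<close>
  have "conj_by (inv a) (conj_by c (b [^] (2::int))) = b [^] (2 + 4 * k + e1 * (16 * p)) \<otimes> y"
  proof -
    have "inv a \<otimes> c = b [^] (2::int) \<otimes> c \<otimes> inv a"
      using conj_inv_a_c by (simp add: conj_by_eq_iff)
    then have "conj_by (inv a) (conj_by c (b [^] (2::int)))
        = conj_by (b [^] (2::int)) (conj_by c (b [^] (2 - e1 * (16 * p))))"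
      by (simp add: conj_by_conj_by conj_inv_a_b2 [symmetric] m_assoc)
    also have "b [^] (2 - e1 * (16 * p)) = b [^] (2::int) \<otimes> b [^] (8 * (e1 * (2 * p)))"
      unfolding int_pow_mult [OF gens(2), symmetric]
      by (rule b_pow_cong [of _ _ "- e1"]) simp
    also have "conj_by c \<dots> = b [^] (2 + 4 * k) \<otimes> (y \<otimes> b [^] (2 * (e1 * (8 * p))))"
      using conj_b8 [of "e1 * (2 * p)"] by (simp add: conj_by_mult conj_b2 m_assoc mult_ac)
    also have "y \<otimes> b [^] (2 * (e1 * (8 * p))) = b [^] (2 * (e1 * (8 * p))) \<otimes> y"
      using y_b [of "e1 * (8 * p)"] by (simp add: conj_by_eq_iff)
    also have "b [^] (2 + 4 * k) \<otimes> (b [^] (2 * (e1 * (8 * p))) \<otimes> y)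
        = b [^] (2 + 4 * k + e1 * (16 * p)) \<otimes> y"
      by (simp add: int_pow_mult_left mult_ac)
    also have "conj_by (b [^] (2::int)) \<dots> = b [^] (2 + 4 * k + e1 * (16 * p)) \<otimes> y"
    proof -
      have "y \<otimes> b [^] (2::int) = b [^] (2::int) \<otimes> y"
        using y_b [of 1] by (simp add: conj_by_eq_iff)
      then show ?thesis
        by (simp add: conj_by_eq_iff m_assoc int_pow_mult_left add.commute)
    qed
    finally show ?thesis .
  qed
  moreover have "conj_by (inv a) (b [^] (2 + 4 * k)) = b [^] (2 + 4 * k + e1 * (16 * p))"
  proof -
    have "conj_by (inv a) (b [^] (2 * (1 + 2 * k))) = b [^] ((2 - e1 * (16 * p)) * (1 + 2 * k))"
      by (rule conj_by_b_pow) (simp_all add: conj_inv_a_b2)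
    also have "\<dots> = b [^] (2 + 4 * k + e1 * (16 * p))"
      by (rule b_pow_cong [of _ _ "- e1 - 2 * e1 * p * e2"]) (simp add: k_def algebra_simps)
    finally show ?thesis
      by simp
  qed
  ultimately have "b [^] (2 + 4 * k + e1 * (16 * p)) \<otimes> (b [^] (16 * p) \<otimes> y)
      = b [^] (2 + 4 * k + e1 * (16 * p)) \<otimes> y"
    by (simp add: conj_b2 conj_by_mult conj_a_y)
  then show ?thesis
    by simp
qed

end

section \<open>Flags of polytopes of rank 4\<close>

text \<open>Zorn's lemma, flags being the maximal chains. It supplies the flags through prescribed
  faces below.\<close>

lemma pchain_subset_flag:
  assumes "pchain P leq C"
  obtains \<Phi> where "flag P leq \<Phi>" "C \<subseteq> \<Phi>"
proof -
  let ?A = "{D. pchain P leq D \<and> C \<subseteq> D}"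
  have "\<exists>M\<in>?A. \<forall>X\<in>?A. M \<subseteq> X \<longrightarrow> X = M"
  proof (rule subset_Zorn_nonempty)
    show "?A \<noteq> {}"
      using assms by blast
    fix \<C> assume ne: "\<C> \<noteq> {}" and ch: "subset.chain ?A \<C>"
    \<comment> \<open>Members of a chain of sets are nested, so any two elements of the union
      already lie in a single member.\<close>
    have "leq x y \<or> leq y x" if "X \<in> \<C>" "Y \<in> \<C>" "x \<in> X" "y \<in> Y" for x y X Y
    proof -
      have "pchain P leq X" "pchain P leq Y" "X \<subseteq> Y \<or> Y \<subseteq> X"
        using ch that(1,2) unfolding subset_chain_def by auto
      then show ?thesis
        using that(3,4) unfolding pchain_def by auto
    qed
    moreover have "X \<subseteq> P \<and> C \<subseteq> X" if "X \<in> \<C>" for X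
      using ch that unfolding subset_chain_def pchain_def by auto
    ultimately show "\<Union>\<C> \<in> ?A"
      using ne unfolding pchain_def by simp blast
  qed
  then obtain M where "pchain P leq M" "C \<subseteq> M"
    and max: "\<And>X. pchain P leq X \<and> C \<subseteq> X \<Longrightarrow> M \<subseteq> X \<Longrightarrow> X = M"
    by auto
  then show thesis
    using that [of M] unfolding flag_def by (meson order_trans)
qed

locale polytope =
  fixes P :: "'a set" and leq :: "'a \<Rightarrow> 'a \<Rightarrow> bool"
  assumes polytope4: "polytope4 P leq"
begin

abbreviation rk where "rk \<equiv> rank P leq"
abbreviation adj where "adj \<equiv> adj_flag P leq"

lemma polytope4_conjuncts:
  shows "\<forall>x\<in>P. leq x x"
    and "\<forall>x\<in>P. \<forall>y\<in>P. leq x y \<and> leq y x \<longrightarrow> x = y"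
    and "\<forall>x\<in>P. \<forall>y\<in>P. \<forall>z\<in>P. leq x y \<and> leq y z \<longrightarrow> leq x z"
    and least: "\<exists>m\<in>P. \<forall>x\<in>P. leq m x"
    and greatest: "\<exists>m\<in>P. \<forall>x\<in>P. leq x m"
    and "\<forall>\<Phi>. flag P leq \<Phi> \<longrightarrow> finite \<Phi> \<and> card \<Phi> = 6"
    and "\<forall>F\<in>P. \<forall>G\<in>P. leq F G \<and> rk G = rk F + 2 \<longrightarrow>
        card {H \<in> P. leq F H \<and> leq H G \<and> H \<noteq> F \<and> H \<noteq> G} = 2"
    and sfc: "strongly_flag_connected P leq"
  using polytope4 unfolding polytope4_def by - (elim conjE, assumption)+

lemma refl: "x \<in> P \<Longrightarrow> leq x x"
  using polytope4_conjuncts(1) by blast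

lemma antisym: "x \<in> P \<Longrightarrow> y \<in> P \<Longrightarrow> leq x y \<Longrightarrow> leq y x \<Longrightarrow> x = y"
  using polytope4_conjuncts(2) by blast

lemma trans: "x \<in> P \<Longrightarrow> y \<in> P \<Longrightarrow> z \<in> P \<Longrightarrow> leq x y \<Longrightarrow> leq y z \<Longrightarrow> leq x z"
  using polytope4_conjuncts(3) by blast

lemma flag_finite: "flag P leq \<Phi> \<Longrightarrow> finite \<Phi>"
  and flag_card: "flag P leq \<Phi> \<Longrightarrow> card \<Phi> = 6"
  using polytope4_conjuncts(6) by auto

lemma diamond: "F \<in> P \<Longrightarrow> G \<in> P \<Longrightarrow> leq F G \<Longrightarrow> rk G = rk F + 2 \<Longrightarrow>
    card {H \<in> P. leq F H \<and> leq H G \<and> H \<noteq> F \<and> H \<noteq> G} = 2"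
  using polytope4_conjuncts(7) by simp

lemma flag_subset: "flag P leq \<Phi> \<Longrightarrow> x \<in> \<Phi> \<Longrightarrow> x \<in> P"
  and flag_total: "flag P leq \<Phi> \<Longrightarrow> x \<in> \<Phi> \<Longrightarrow> y \<in> \<Phi> \<Longrightarrow> leq x y \<or> leq y x"
  unfolding flag_def pchain_def by auto

lemma flag_subset_eq: "flag P leq \<Phi> \<Longrightarrow> flag P leq \<Psi> \<Longrightarrow> \<Phi> \<subseteq> \<Psi> \<Longrightarrow> \<Psi> = \<Phi>"
  unfolding flag_def by simp

text \<open>A chain of 6 elements fills any flag containing it. Maximality thus becomes a count,
  which automorphisms preserve.\<close>

lemma flag_iff_card: "flag P leq \<Phi> \<longleftrightarrow> pchain P leq \<Phi> \<and> card \<Phi> = 6"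
proof
  assume "pchain P leq \<Phi> \<and> card \<Phi> = 6"
  moreover then obtain \<Psi> where "flag P leq \<Psi>" "\<Phi> \<subseteq> \<Psi>"
    using pchain_subset_flag by blast
  ultimately show "flag P leq \<Phi>"
    using card_subset_eq flag_card flag_finite by metis
qed (auto simp: flag_card flag_def)

text \<open>\<open>rank\<close> picks an arbitrary flag through the face, so the count must not
  depend on the choice. The part of \<open>A\<close> strictly below \<open>F\<close> and the part of
  \<open>B\<close> from \<open>F\<close> upwards form a flag, which has 6 elements; varying
  \<open>A\<close> with \<open>B\<close> fixed gives the claim.\<close>

lemma card_below_flag_eq:
  assumes "flag P leq \<Phi>" "flag P leq \<Psi>" "F \<in> \<Phi>" "F \<in> \<Psi>"
  shows "card {G \<in> \<Phi>. leq G F \<and> G \<noteq> F} = card {G \<in> \<Psi>. leq G F \<and> G \<noteq> F}"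
proof -
  have split: "card {G \<in> A. leq G F \<and> G \<noteq> F} + card {G \<in> B. leq F G} = 6"
    if A: "flag P leq A" "F \<in> A" and B: "flag P leq B" "F \<in> B" for A B
  proof -
    let ?L = "{G \<in> A. leq G F \<and> G \<noteq> F}" and ?U = "{G \<in> B. leq F G}"
    have inP: "x \<in> P" if "x \<in> A \<union> B" for x
      using A B that flag_subset by blast
    have "flag P leq (?L \<union> ?U)"
      unfolding flag_def
    proof (intro conjI allI impI)
      have "leq x y \<or> leq y x" if "x \<in> ?L \<union> ?U" "y \<in> ?L \<union> ?U" for x y
        using that flag_total [OF A(1)] flag_total [OF B(1)] trans [of x F y] trans [of y F x] inP A(2)
        by blast
      then show "pchain P leq (?L \<union> ?U)"
        using inP unfolding pchain_def by blast
      fix C assume C: "pchain P leq C \<and> ?L \<union> ?U \<subseteq> C"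
      have "F \<in> ?U"
        using refl inP B by blast
      have "x \<in> ?L \<union> ?U" if "x \<in> C" for x
      proof (cases "leq F x")
        case True
        have "pchain P leq (insert x B)"
        proof -
          have "leq x z \<or> leq z x" if "z \<in> B" for z
            using C \<open>x \<in> C\<close> that True trans [of z F x] flag_total [OF B(1) that B(2)] inP B(2)
            unfolding pchain_def by blast
          moreover have "x \<in> P"
            using C \<open>x \<in> C\<close> unfolding pchain_def by blast
          ultimately show ?thesis
            using B(1) refl unfolding flag_def pchain_def by blast
        qed
        then have "x \<in> B"
          using B(1) unfolding flag_def by blast
        then show ?thesis
          using True by blast
      next
        case False
        then have xF: "leq x F"
          using C \<open>x \<in> C\<close> \<open>F \<in> ?U\<close> unfolding pchain_def by blast
        have "pchain P leq (insert x A)"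
        proof -
          have "leq x z \<or> leq z x" if "z \<in> A" for z
            using C \<open>x \<in> C\<close> \<open>F \<in> ?U\<close> that xF trans [of x F z] flag_total [OF A(1) that A(2)] inP A(2)
            unfolding pchain_def by blast
          moreover have "x \<in> P"
            using C \<open>x \<in> C\<close> unfolding pchain_def by blast
          ultimately show ?thesis
            using A(1) refl unfolding flag_def pchain_def by blast
        qed
        then have "x \<in> A"
          using A(1) unfolding flag_def by blast
        then show ?thesis
          using xF False refl inP by blast
      qed
      then show "C = ?L \<union> ?U"
        using C by blast
    qed
    moreover have "?L \<inter> ?U = {}"
      using antisym inP A(2) by blast
    moreover have "finite ?L" "finite ?U"
      using A B flag_finite by auto
    ultimately show ?thesis
      using flag_card card_Un_disjoint by metis
  qed
  show ?thesis
    using split [of \<Phi> \<Phi>] split [of \<Psi> \<Phi>] assms by simp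
qed

lemma rank_eq_in_flag:
  assumes "flag P leq \<Phi>" "F \<in> \<Phi>"
  shows "rk F = int (card {G \<in> \<Phi>. leq G F \<and> G \<noteq> F}) - 1"
proof -
  have "flag P leq (SOME \<Phi>. flag P leq \<Phi> \<and> F \<in> \<Phi>) \<and> F \<in> (SOME \<Phi>. flag P leq \<Phi> \<and> F \<in> \<Phi>)"
    by (rule someI) (use assms in blast)
  then show ?thesis
    using card_below_flag_eq [OF assms(1) conjunct1 assms(2) conjunct2] unfolding rank_def by simp
qed

lemma rank_strict_mono:
  assumes "x \<in> P" "y \<in> P" "leq x y" "x \<noteq> y"
  shows "rk x < rk y"
proof -
  have "pchain P leq {x, y}"
    using assms refl unfolding pchain_def by blast
  then obtain \<Phi> where \<Phi>: "flag P leq \<Phi>" "{x, y} \<subseteq> \<Phi>"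
    using pchain_subset_flag by blast
  have "{G \<in> \<Phi>. leq G x \<and> G \<noteq> x} \<subset> {G \<in> \<Phi>. leq G y \<and> G \<noteq> y}"
    using \<Phi> assms trans [of _ x y] antisym [of x y] flag_subset by blast
  then show ?thesis
    using \<Phi> rank_eq_in_flag [OF \<Phi>(1)] psubset_card_mono [of "{G \<in> \<Phi>. leq G y \<and> G \<noteq> y}"]
      flag_finite [OF \<Phi>(1)] by simp
qed

lemma leq_iff_rank:
  assumes "flag P leq \<Phi>" "x \<in> \<Phi>" "y \<in> \<Phi>"
  shows "leq x y \<longleftrightarrow> rk x \<le> rk y"
proof -
  have "x \<in> P" "y \<in> P"
    using assms flag_subset by auto
  then show ?thesis
    using rank_strict_mono [of x y] rank_strict_mono [of y x] flag_total [OF assms] refl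
    by (cases "x = y") auto
qed

section \<open>Flags as families of faces indexed by rank\<close>

lemma rank_bij_flag:
  assumes "flag P leq \<Phi>"
  shows "bij_betw rk \<Phi> {-1..4}"
proof -
  have inj: "inj_on rk \<Phi>"
    using leq_iff_rank [OF assms] antisym flag_subset [OF assms] by (intro inj_onI) simp
  have "rk x \<in> {-1..4}" if "x \<in> \<Phi>" for x
  proof -
    have "card {G \<in> \<Phi>. leq G x \<and> G \<noteq> x} < card \<Phi>"
      by (rule psubset_card_mono) (use that assms flag_finite in auto)
    then show ?thesis
      using rank_eq_in_flag [OF assms that] flag_card [OF assms] by auto
  qed
  then have "rk ` \<Phi> \<subseteq> {-1..4}"
    by blast
  moreover have "card (rk ` \<Phi>) = card {-1..4::int}"
    using inj card_image flag_card [OF assms] by fastforce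
  ultimately show ?thesis
    using inj card_subset_eq unfolding bij_betw_def by blast
qed

text \<open>The inverse of the bijection in \<open>rank_bij_flag\<close>, hence meaningful only for
  \<open>i\<close> from -1 to 4. It turns questions of membership in flags into equations between
  faces.\<close>

definition face :: "'a set \<Rightarrow> int \<Rightarrow> 'a" where
  "face \<Phi> i = inv_into \<Phi> rk i"

lemma
  assumes "flag P leq \<Phi>" "-1 \<le> i" "i \<le> 4"
  shows face_in: "face \<Phi> i \<in> \<Phi>" and rank_face: "rk (face \<Phi> i) = i"
proof -
  have i: "i \<in> {-1..4}"
    using assms by simp
  show "face \<Phi> i \<in> \<Phi>"
    unfolding face_def
    by (rule bij_betw_apply [OF bij_betw_inv_into [OF rank_bij_flag [OF assms(1)]] i])
  show "rk (face \<Phi> i) = i"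
    unfolding face_def by (rule bij_betw_inv_into_right [OF rank_bij_flag [OF assms(1)] i])
qed

lemma face_rank: "flag P leq \<Phi> \<Longrightarrow> x \<in> \<Phi> \<Longrightarrow> face \<Phi> (rk x) = x"
  unfolding face_def by (rule bij_betw_inv_into_left [OF rank_bij_flag])

lemma face_in_P: "flag P leq \<Phi> \<Longrightarrow> -1 \<le> i \<Longrightarrow> i \<le> 4 \<Longrightarrow> face \<Phi> i \<in> P"
  by (rule flag_subset [OF _ face_in])

lemma rank_range: "flag P leq \<Phi> \<Longrightarrow> x \<in> \<Phi> \<Longrightarrow> -1 \<le> rk x \<and> rk x \<le> 4"
  using bij_betw_apply [OF rank_bij_flag, of \<Phi> x] by simp

lemma face_eqI: "flag P leq \<Phi> \<Longrightarrow> x \<in> \<Phi> \<Longrightarrow> rk x = i \<Longrightarrow> face \<Phi> i = x"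
  using face_rank [of \<Phi> x] by simp

lemma flag_eqI:
  assumes "flag P leq \<Phi>" "flag P leq \<Psi>" "\<And>i. -1 \<le> i \<Longrightarrow> i \<le> 4 \<Longrightarrow> face \<Phi> i = face \<Psi> i"
  shows "\<Phi> = \<Psi>"
proof -
  have "x \<in> \<Psi>" if "x \<in> \<Phi>" for x
    using assms(3) [of "rk x"] face_in [OF assms(2), of "rk x"]
      rank_range [OF assms(1) that] face_rank [OF assms(1) that] by simp
  then show ?thesis
    using flag_subset_eq [OF assms(1,2)] by blast
qed

lemma face_leq:
  assumes "flag P leq \<Phi>" "-1 \<le> i" "i \<le> k" "k \<le> 4"
  shows "leq (face \<Phi> i) (face \<Phi> k)"
  using assms by (subst leq_iff_rank [OF assms(1)]) (simp_all add: face_in rank_face)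

section \<open>The diamond condition and adjacent flags\<close>

lemma rank_between:
  assumes "flag P leq \<Phi>" "-1 \<le> i" "k \<le> 4" "i < k" "H \<in> P"
    "leq (face \<Phi> i) H" "leq H (face \<Phi> k)" "H \<noteq> face \<Phi> i" "H \<noteq> face \<Phi> k"
  shows "i < rk H" "rk H < k"
  using rank_strict_mono [of "face \<Phi> i" H] rank_strict_mono [of H "face \<Phi> k"] assms
    rank_face [of \<Phi> i] rank_face [of \<Phi> k] face_in_P [of \<Phi> i] face_in_P [of \<Phi> k] by auto

lemma face_in_diamond:
  assumes "flag P leq \<Phi>" "0 \<le> j" "j \<le> 3"
  shows "face \<Phi> j \<in> {H \<in> P. leq (face \<Phi> (j - 1)) H \<and> leq H (face \<Phi> (j + 1))
      \<and> H \<noteq> face \<Phi> (j - 1) \<and> H \<noteq> face \<Phi> (j + 1)}"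
proof -
  have "face \<Phi> j \<noteq> face \<Phi> (j - 1)" "face \<Phi> j \<noteq> face \<Phi> (j + 1)"
    using rank_face [OF assms(1), of j] rank_face [OF assms(1), of "j - 1"]
      rank_face [OF assms(1), of "j + 1"] assms(2,3) by auto
  then show ?thesis
    using assms face_leq [of \<Phi> "j - 1" j] face_leq [of \<Phi> j "j + 1"] face_in_P by auto
qed

lemma diamond_card:
  assumes "flag P leq \<Phi>" "0 \<le> j" "j \<le> 3"
  shows "card {H \<in> P. leq (face \<Phi> (j - 1)) H \<and> leq H (face \<Phi> (j + 1))
      \<and> H \<noteq> face \<Phi> (j - 1) \<and> H \<noteq> face \<Phi> (j + 1)} = 2"
  by (rule diamond) (use assms face_in_P face_leq rank_face in auto)

text \<open>Between fixed neighbours the diamond condition leaves only two candidates at rank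
  \<open>j\<close>, so two faces that both avoid one candidate coincide.\<close>

lemma third_face_eq:
  assumes "flag P leq \<Phi>" "flag P leq \<Psi>" "flag P leq \<Omega>" "0 \<le> j" "j \<le> 3"
    and "face \<Psi> (j - 1) = face \<Phi> (j - 1)" "face \<Psi> (j + 1) = face \<Phi> (j + 1)"
    and "face \<Omega> (j - 1) = face \<Phi> (j - 1)" "face \<Omega> (j + 1) = face \<Phi> (j + 1)"
    and "face \<Psi> j \<noteq> face \<Phi> j" "face \<Omega> j \<noteq> face \<Phi> j"
  shows "face \<Psi> j = face \<Omega> j"
proof -
  let ?D = "{H \<in> P. leq (face \<Phi> (j - 1)) H \<and> leq H (face \<Phi> (j + 1))
      \<and> H \<noteq> face \<Phi> (j - 1) \<and> H \<noteq> face \<Phi> (j + 1)}"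
  have "face \<Phi> j \<in> ?D" "face \<Psi> j \<in> ?D" "face \<Omega> j \<in> ?D"
    using face_in_diamond [OF assms(1,4,5)] face_in_diamond [OF assms(2,4,5)]
      face_in_diamond [OF assms(3,4,5)] unfolding assms(6-9) .
  moreover obtain u v where uv: "?D = {u, v}"
    using diamond_card [OF assms(1,4,5)] unfolding card_2_iff by blast
  ultimately have "face \<Phi> j \<in> {u, v}" "face \<Psi> j \<in> {u, v}" "face \<Omega> j \<in> {u, v}"
    by (simp_all only: uv)
  then show ?thesis
    using assms(10,11) by auto
qed

text \<open>Applied with \<open>k = i + 2\<close> to build adjacent flags, and with
  \<open>k = i + 3\<close> to put a vertex of a polygonal section into a flag.\<close>

lemma insert_pchain:
  assumes \<Phi>: "flag P leq \<Phi>" and ik: "-1 \<le> i" "k \<le> 4" "i < k" and H: "H \<in> P"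
    "leq (face \<Phi> i) H" "leq H (face \<Phi> k)"
  shows "pchain P leq (insert H {x \<in> \<Phi>. rk x \<le> i \<or> k \<le> rk x})"
proof -
  have "leq x H \<or> leq H x" if x: "x \<in> \<Phi>" "rk x \<le> i \<or> k \<le> rk x" for x
    using x(2)
  proof
    assume "rk x \<le> i"
    then have "leq x (face \<Phi> i)"
      using leq_iff_rank [OF \<Phi> x(1) face_in] rank_face \<Phi> ik by simp
    then show ?thesis
      using trans [of x "face \<Phi> i" H] flag_subset [OF \<Phi> x(1)] face_in_P [OF \<Phi>, of i] ik H by auto
  next
    assume "k \<le> rk x"
    then have "leq (face \<Phi> k) x"
      using leq_iff_rank [OF \<Phi> face_in x(1)] rank_face \<Phi> ik by simp
    then show ?thesis
      using trans [of H "face \<Phi> k" x] flag_subset [OF \<Phi> x(1)] face_in_P [OF \<Phi>, of k] ik H by auto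
  qed
  then show ?thesis
    using \<Phi> H refl unfolding flag_def pchain_def by auto
qed

lemma adjacent_flag_exists:
  assumes \<Phi>: "flag P leq \<Phi>" and j: "0 \<le> j" "j \<le> 3"
  obtains \<Psi> where "flag P leq \<Psi>" "\<And>i. -1 \<le> i \<Longrightarrow> i \<le> 4 \<Longrightarrow> i \<noteq> j \<Longrightarrow> face \<Psi> i = face \<Phi> i"
    "face \<Psi> j \<noteq> face \<Phi> j"
proof -
  let ?D = "{H \<in> P. leq (face \<Phi> (j - 1)) H \<and> leq H (face \<Phi> (j + 1))
      \<and> H \<noteq> face \<Phi> (j - 1) \<and> H \<noteq> face \<Phi> (j + 1)}"
  obtain u v where uv: "?D = {u, v}" "u \<noteq> v"
    using diamond_card [OF assms] unfolding card_2_iff by blast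
  then obtain H where H: "H \<in> ?D" "H \<noteq> face \<Phi> j"
    by blast
  then have rkH: "rk H = j"
    using rank_between [OF \<Phi>, of "j - 1" "j + 1" H] j by simp
  have "pchain P leq (insert H {x \<in> \<Phi>. rk x \<le> j - 1 \<or> j + 1 \<le> rk x})"
    by (rule insert_pchain [OF \<Phi>]) (use H j in auto)
  then obtain \<Psi> where \<Psi>: "flag P leq \<Psi>" "insert H {x \<in> \<Phi>. rk x \<le> j - 1 \<or> j + 1 \<le> rk x} \<subseteq> \<Psi>"
    by (rule pchain_subset_flag)
  show thesis
  proof
    show "flag P leq \<Psi>"
      by fact
    show "face \<Psi> i = face \<Phi> i" if "-1 \<le> i" "i \<le> 4" "i \<noteq> j" for i
      by (rule face_eqI) (use that \<Psi> face_in [OF \<Phi>, of i] rank_face [OF \<Phi>, of i] in auto)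
    have "face \<Psi> j = H"
      by (rule face_eqI) (use \<Psi> rkH in auto)
    then show "face \<Psi> j \<noteq> face \<Phi> j"
      using H by simp
  qed
qed

text \<open>Translates the condition in \<open>adj_flag\<close> into one on faces. Flags that agree
  at all other ranks must differ at rank \<open>j\<close>, for otherwise they are equal.\<close>

lemma adjacent_iff_faces:
  assumes "flag P leq \<Phi>" "flag P leq \<Psi>" "0 \<le> j" "j \<le> 3"
  shows "\<Psi> \<noteq> \<Phi> \<and> (\<forall>F\<in>\<Phi>. rk F \<noteq> j \<longrightarrow> F \<in> \<Psi>) \<longleftrightarrow>
    face \<Psi> j \<noteq> face \<Phi> j \<and> (\<forall>i. -1 \<le> i \<and> i \<le> 4 \<and> i \<noteq> j \<longrightarrow> face \<Psi> i = face \<Phi> i)"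
proof -
  have "(\<forall>F\<in>\<Phi>. rk F \<noteq> j \<longrightarrow> F \<in> \<Psi>) \<longleftrightarrow> (\<forall>i. -1 \<le> i \<and> i \<le> 4 \<and> i \<noteq> j \<longrightarrow> face \<Psi> i = face \<Phi> i)"
  proof (intro iffI allI impI ballI)
    fix i assume *: "\<forall>F\<in>\<Phi>. rk F \<noteq> j \<longrightarrow> F \<in> \<Psi>" "-1 \<le> i \<and> i \<le> 4 \<and> i \<noteq> j"
    then have "face \<Phi> i \<in> \<Psi>"
      using face_in [OF assms(1)] rank_face [OF assms(1)] by auto
    then show "face \<Psi> i = face \<Phi> i"
      using * face_eqI [OF assms(2)] rank_face [OF assms(1)] by auto
  next
    fix F assume *: "\<forall>i. -1 \<le> i \<and> i \<le> 4 \<and> i \<noteq> j \<longrightarrow> face \<Psi> i = face \<Phi> i" "F \<in> \<Phi>" "rk F \<noteq> j"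
    then have "face \<Psi> (rk F) = F"
      using rank_range [OF assms(1) *(2)] face_rank [OF assms(1) *(2)] by auto
    then show "F \<in> \<Psi>"
      using face_in [OF assms(2), of "rk F"] rank_range [OF assms(1) *(2)] by auto
  qed
  moreover have "\<Psi> = \<Phi>" if "face \<Psi> j = face \<Phi> j" "\<forall>i. -1 \<le> i \<and> i \<le> 4 \<and> i \<noteq> j \<longrightarrow> face \<Psi> i = face \<Phi> i"
    using that by (intro flag_eqI [OF assms(2,1)]) metis
  ultimately show ?thesis
    by blast
qed

text \<open>\<open>adj_flag\<close> is a definite description; its uniqueness rests on
  \<open>third_face_eq\<close>.\<close>

lemma adj_eqI:
  assumes "flag P leq \<Phi>" "0 \<le> j" "j \<le> 3" "flag P leq \<Psi>" "face \<Psi> j \<noteq> face \<Phi> j"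
    "\<And>i. -1 \<le> i \<Longrightarrow> i \<le> 4 \<Longrightarrow> i \<noteq> j \<Longrightarrow> face \<Psi> i = face \<Phi> i"
  shows "adj \<Phi> j = \<Psi>"
  unfolding adj_flag_def
proof (rule the_equality)
  show "flag P leq \<Psi> \<and> \<Psi> \<noteq> \<Phi> \<and> (\<forall>F\<in>\<Phi>. rk F \<noteq> j \<longrightarrow> F \<in> \<Psi>)"
    using adjacent_iff_faces [OF assms(1,4,2,3)] assms by blast
next
  fix \<Omega> assume *: "flag P leq \<Omega> \<and> \<Omega> \<noteq> \<Phi> \<and> (\<forall>F\<in>\<Phi>. rk F \<noteq> j \<longrightarrow> F \<in> \<Omega>)"
  then have \<Omega>: "flag P leq \<Omega>" "face \<Omega> j \<noteq> face \<Phi> j"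
      "\<And>i. -1 \<le> i \<Longrightarrow> i \<le> 4 \<Longrightarrow> i \<noteq> j \<Longrightarrow> face \<Omega> i = face \<Phi> i"
    using adjacent_iff_faces [OF assms(1) _ assms(2,3)] by blast+
  have "face \<Omega> j = face \<Psi> j"
    by (rule third_face_eq [OF assms(1) \<Omega>(1) assms(4,2,3)]) (use assms \<Omega> in auto)
  then show "\<Omega> = \<Psi>"
    using \<Omega> assms by (intro flag_eqI) metis+
qed

lemma
  assumes "flag P leq \<Phi>" "0 \<le> j" "j \<le> 3"
  shows adj_is_flag: "flag P leq (adj \<Phi> j)"
    and face_adj_other: "-1 \<le> i \<Longrightarrow> i \<le> 4 \<Longrightarrow> i \<noteq> j \<Longrightarrow> face (adj \<Phi> j) i = face \<Phi> i"
    and face_adj_neq: "face (adj \<Phi> j) j \<noteq> face \<Phi> j"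
proof -
  obtain \<Psi> where \<Psi>: "flag P leq \<Psi>" "\<And>i. -1 \<le> i \<Longrightarrow> i \<le> 4 \<Longrightarrow> i \<noteq> j \<Longrightarrow> face \<Psi> i = face \<Phi> i"
    "face \<Psi> j \<noteq> face \<Phi> j"
    using adjacent_flag_exists [OF assms] by metis
  then have "adj \<Phi> j = \<Psi>"
    using assms by (intro adj_eqI) auto
  then show "flag P leq (adj \<Phi> j)" "-1 \<le> i \<Longrightarrow> i \<le> 4 \<Longrightarrow> i \<noteq> j \<Longrightarrow> face (adj \<Phi> j) i = face \<Phi> i"
    "face (adj \<Phi> j) j \<noteq> face \<Phi> j"
    using \<Psi> by simp_all
qed

lemma adj_adj: "flag P leq \<Phi> \<Longrightarrow> 0 \<le> j \<Longrightarrow> j \<le> 3 \<Longrightarrow> adj (adj \<Phi> j) j = \<Phi>"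
  using face_adj_neq [of \<Phi> j] by (intro adj_eqI) (auto simp: adj_is_flag face_adj_other)

text \<open>As \<open>i + 2 \<le> j\<close>, a change at rank \<open>i\<close> leaves the neighbours
  of rank \<open>j\<close> alone. After changes at \<open>j\<close>, \<open>i\<close> and
  \<open>j\<close> again, the second change at \<open>j\<close> has therefore undone the first, and
  only the change at \<open>i\<close> remains.\<close>

lemma adj_commute:
  assumes \<Phi>: "flag P leq \<Phi>" and i: "0 \<le> i" and ij: "i + 2 \<le> j" and j: "j \<le> 3"
  shows "adj (adj \<Phi> j) i = adj (adj \<Phi> i) j"
proof -
  let ?A = "adj \<Phi> j"
  let ?B = "adj ?A i"
  let ?E = "adj ?B j"
  have bounds: "i \<le> 3" "0 \<le> j" "i \<noteq> j"
    using i ij j by auto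
  have fl: "flag P leq ?A" "flag P leq ?B" "flag P leq ?E"
    using \<Phi> i j bounds by (simp_all add: adj_is_flag)
  have E: "face ?E k = face \<Phi> k" if "-1 \<le> k" "k \<le> 4" "k \<noteq> i" "k \<noteq> j" for k
    using that \<Phi> fl(1,2) i j bounds by (simp add: face_adj_other)
  have Aj: "face ?A j = face ?B j"
    using fl(1) i j bounds by (simp add: face_adj_other)
  have "face ?E j = face \<Phi> j"
  proof (rule third_face_eq [OF fl(1,3) \<Phi> bounds(2) j])
    show "face ?E j \<noteq> face ?A j"
      unfolding Aj by (rule face_adj_neq [OF fl(2) bounds(2) j])
    show "face \<Phi> j \<noteq> face ?A j"
      using face_adj_neq [OF \<Phi> bounds(2) j] by simp
  qed (use E [of "j - 1"] E [of "j + 1"] \<Phi> i ij j bounds in \<open>simp_all add: face_adj_other\<close>)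
  moreover have "face ?E i \<noteq> face \<Phi> i"
    using face_adj_neq [OF fl(1) i bounds(1)] \<Phi> fl(2) i j bounds by (simp add: face_adj_other)
  ultimately have "adj \<Phi> i = ?E"
    using E by (intro adj_eqI [OF \<Phi> i bounds(1) fl(3)]) metis+
  then show ?thesis
    using fl j bounds by (simp add: adj_adj)
qed

subsection \<open>Automorphisms\<close>

abbreviation \<Gamma> where "\<Gamma> \<equiv> autgrp P leq"

lemma aut_carrier: "f \<in> carrier \<Gamma> \<longleftrightarrow> f \<in> Bij P \<and> (\<forall>x\<in>P. \<forall>y\<in>P. leq x y \<longleftrightarrow> leq (f x) (f y))"
  by (simp add: autgrp_def)

lemma aut_in_P: "f \<in> carrier \<Gamma> \<Longrightarrow> x \<in> P \<Longrightarrow> f x \<in> P"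
  using Bij_imp_funcset by (auto simp: aut_carrier)

lemma aut_inj: "f \<in> carrier \<Gamma> \<Longrightarrow> inj_on f P"
  by (simp add: aut_carrier Bij_def bij_betw_def)

lemma aut_leq: "f \<in> carrier \<Gamma> \<Longrightarrow> x \<in> P \<Longrightarrow> y \<in> P \<Longrightarrow> leq (f x) (f y) \<longleftrightarrow> leq x y"
  by (simp add: aut_carrier)

lemma aut_mult_apply: "x \<in> P \<Longrightarrow> (f \<otimes>\<^bsub>\<Gamma>\<^esub> g) x = g (f x)"
  by (simp add: autgrp_def compose_def)

lemma aut_one_apply: "x \<in> P \<Longrightarrow> \<one>\<^bsub>\<Gamma>\<^esub> x = x"
  by (simp add: autgrp_def)

lemma group_aut: "group \<Gamma>"
proof (rule groupI)
  fix f g assume fg: "f \<in> carrier \<Gamma>" "g \<in> carrier \<Gamma>"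
  have "compose P g f \<in> Bij P"
    using fg by (simp add: aut_carrier compose_Bij)
  moreover have "f \<otimes>\<^bsub>\<Gamma>\<^esub> g = compose P g f"
    by (simp add: autgrp_def)
  ultimately show "f \<otimes>\<^bsub>\<Gamma>\<^esub> g \<in> carrier \<Gamma>"
    using aut_leq [OF fg(1)] aut_leq [OF fg(2)] aut_in_P [OF fg(1)]
    by (simp add: aut_carrier compose_def)
  fix h assume h: "h \<in> carrier \<Gamma>"
  show "f \<otimes>\<^bsub>\<Gamma>\<^esub> g \<otimes>\<^bsub>\<Gamma>\<^esub> h = f \<otimes>\<^bsub>\<Gamma>\<^esub> (g \<otimes>\<^bsub>\<Gamma>\<^esub> h)"
    using aut_in_P [OF fg(1)] by (auto simp: autgrp_def compose_def fun_eq_iff)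
next
  show "\<one>\<^bsub>\<Gamma>\<^esub> \<in> carrier \<Gamma>"
    by (simp add: autgrp_def id_Bij)
next
  fix f assume f: "f \<in> carrier \<Gamma>"
  show "\<one>\<^bsub>\<Gamma>\<^esub> \<otimes>\<^bsub>\<Gamma>\<^esub> f = f"
    using f by (auto simp: autgrp_def Bij_def extensional_def compose_def fun_eq_iff)
  let ?g = "\<lambda>x\<in>P. inv_into P f x"
  have f_Bij: "f \<in> Bij P" "f ` P = P"
    using f by (auto simp: aut_carrier Bij_def bij_betw_def)
  have g: "inv_into P f x \<in> P" "f (inv_into P f x) = x" if "x \<in> P" for x
    using that f_Bij(2) by (auto intro: inv_into_into f_inv_into_f)
  have "leq (?g x) (?g y) \<longleftrightarrow> leq x y" if "x \<in> P" "y \<in> P" for x y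
    using aut_leq [OF f, of "?g x" "?g y"] that g by simp
  then have "?g \<in> carrier \<Gamma>"
    using f_Bij(1) by (simp add: aut_carrier restrict_inv_into_Bij)
  moreover have "?g \<otimes>\<^bsub>\<Gamma>\<^esub> f = \<one>\<^bsub>\<Gamma>\<^esub>"
    using g by (auto simp: autgrp_def compose_def fun_eq_iff)
  ultimately show "\<exists>g\<in>carrier \<Gamma>. g \<otimes>\<^bsub>\<Gamma>\<^esub> f = \<one>\<^bsub>\<Gamma>\<^esub>"
    by blast
qed

sublocale aut: group \<Gamma>
  by (rule group_aut)

lemma aut_image_mult: "A \<subseteq> P \<Longrightarrow> (f \<otimes>\<^bsub>\<Gamma>\<^esub> g) ` A = g ` f ` A"
  by (auto simp: aut_mult_apply image_image subset_eq intro!: image_cong)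

lemma flag_subset_P: "flag P leq \<Phi> \<Longrightarrow> \<Phi> \<subseteq> P"
  using flag_subset by auto

lemma aut_flag:
  assumes "f \<in> carrier \<Gamma>" "flag P leq \<Phi>"
  shows "flag P leq (f ` \<Phi>)"
proof -
  have "card (f ` \<Phi>) = 6"
    using card_image [OF inj_on_subset [OF aut_inj [OF assms(1)] flag_subset_P [OF assms(2)]]]
      flag_card [OF assms(2)] by simp
  moreover have "pchain P leq (f ` \<Phi>)"
    using aut_in_P [OF assms(1)] aut_leq [OF assms(1)] flag_total [OF assms(2)] flag_subset [OF assms(2)]
    unfolding pchain_def by auto
  ultimately show ?thesis
    by (simp add: flag_iff_card)
qed

lemma in_some_flag:
  assumes "x \<in> P"
  obtains \<Phi> where "flag P leq \<Phi>" "x \<in> \<Phi>"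
proof -
  have "pchain P leq {x}"
    using assms refl unfolding pchain_def by simp
  then show thesis
    using that by (auto elim: pchain_subset_flag)
qed

lemma aut_rank:
  assumes f: "f \<in> carrier \<Gamma>" and "x \<in> P"
  shows "rk (f x) = rk x"
proof -
  obtain \<Phi> where \<Phi>: "flag P leq \<Phi>" "x \<in> \<Phi>"
    using in_some_flag [OF \<open>x \<in> P\<close>] by metis
  have inP: "y \<in> P" if "y \<in> \<Phi>" for y
    using flag_subset [OF \<Phi>(1) that] .
  have "{G \<in> f ` \<Phi>. leq G (f x) \<and> G \<noteq> f x} = f ` {G \<in> \<Phi>. leq G x \<and> G \<noteq> x}"
    using aut_leq [OF f] inP \<Phi>(2) inj_onD [OF aut_inj [OF f]] by auto
  moreover have "card (f ` {G \<in> \<Phi>. leq G x \<and> G \<noteq> x}) = card {G \<in> \<Phi>. leq G x \<and> G \<noteq> x}"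
    by (rule card_image [OF inj_on_subset [OF aut_inj [OF f]]]) (use inP in auto)
  ultimately show ?thesis
    using rank_eq_in_flag [OF \<Phi>] rank_eq_in_flag [OF aut_flag [OF f \<Phi>(1)], of "f x"] \<Phi>(2) by simp
qed

lemma aut_face:
  assumes "f \<in> carrier \<Gamma>" "flag P leq \<Phi>" "-1 \<le> i" "i \<le> 4"
  shows "face (f ` \<Phi>) i = f (face \<Phi> i)"
  by (rule face_eqI [OF aut_flag [OF assms(1,2)]])
    (simp_all add: assms face_in aut_rank face_in_P rank_face)

text \<open>Automorphisms are injective and preserve rank, so they respect the description of
  adjacency by faces. This turns images of the base flag under products of generators into sequences
  of adjacencies.\<close>

lemma aut_adj:
  assumes f: "f \<in> carrier \<Gamma>" and \<Phi>: "flag P leq \<Phi>" and j: "0 \<le> j" "j \<le> 3"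
  shows "f ` adj \<Phi> j = adj (f ` \<Phi>) j"
proof (rule adj_eqI [symmetric])
  have fl: "flag P leq (adj \<Phi> j)"
    using \<Phi> j by (simp add: adj_is_flag)
  show "flag P leq (f ` \<Phi>)" "flag P leq (f ` adj \<Phi> j)"
    using f \<Phi> fl aut_flag by auto
  have "f (face (adj \<Phi> j) j) \<noteq> f (face \<Phi> j)"
    using face_adj_neq [OF \<Phi> j] inj_onD [OF aut_inj [OF f]] face_in_P [OF fl, of j] face_in_P [OF \<Phi>, of j] j
    by auto
  then show "face (f ` adj \<Phi> j) j \<noteq> face (f ` \<Phi>) j"
    using f \<Phi> fl j by (simp add: aut_face)
  show "face (f ` adj \<Phi> j) i = face (f ` \<Phi>) i" if "-1 \<le> i" "i \<le> 4" "i \<noteq> j" for i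
    using f \<Phi> fl j that by (simp add: aut_face face_adj_other)
qed (fact j)+

section \<open>Flag-connectedness and the free action on flags\<close>

lemma face_extreme:
  assumes "flag P leq \<Phi>" "flag P leq \<Psi>" "i = -1 \<or> i = 4"
  shows "face \<Phi> i = face \<Psi> i"
proof -
  obtain l u where l: "l \<in> P" "\<forall>x\<in>P. leq l x" and u: "u \<in> P" "\<forall>x\<in>P. leq x u"
    using least greatest by auto
  have "face A (-1) = l" "face A 4 = u" if A: "flag P leq A" for A
  proof -
    have "pchain P leq (insert l A)" "pchain P leq (insert u A)"
      using A l u unfolding flag_def pchain_def by auto
    then have in_A: "l \<in> A" "u \<in> A"
      using A unfolding flag_def by blast+
    have "leq l (face A (-1))" "leq (face A 4) u"
      using l u face_in_P [OF A] by auto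
    then have "rk l \<le> -1" "4 \<le> rk u"
      using leq_iff_rank [OF A in_A(1) face_in [OF A, of "-1"]] leq_iff_rank [OF A face_in [OF A, of 4] in_A(2)]
        rank_face [OF A] by auto
    then have "rk l = -1" "rk u = 4"
      using rank_range [OF A in_A(1)] rank_range [OF A in_A(2)] by auto
    then show "face A (-1) = l" "face A 4 = u"
      using face_eqI [OF A in_A(1)] face_eqI [OF A in_A(2)] by auto
  qed
  then show ?thesis
    using assms by auto
qed

text \<open>The single lost face cannot have rank -1 or 4, since the least and greatest faces lie in
  every flag. Each step of flag-connectedness is therefore an adjacency.\<close>

lemma adjacent_flag_eq_adj:
  assumes A: "flag P leq A" and B: "flag P leq B" and "card (A - B) = 1"
  obtains j where "0 \<le> j" "j \<le> 3" "B = adj A j"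
proof -
  obtain x where x: "A - B = {x}"
    using assms(3) by (auto simp: card_1_singleton_iff)
  have same: "face B i = face A i" if "-1 \<le> i" "i \<le> 4" "i \<noteq> rk x" for i
  proof -
    have "face A i \<noteq> x"
      using rank_face [OF A that(1,2)] that(3) by auto
    then have "face A i \<in> B"
      using x face_in [OF A that(1,2)] by auto
    then show ?thesis
      using face_eqI [OF B] rank_face [OF A that(1,2)] by auto
  qed
  have "B \<noteq> A"
    using x by auto
  then have neq: "face B (rk x) \<noteq> face A (rk x)"
    using flag_eqI [OF B A] same by metis
  have "-1 \<le> rk x" "rk x \<le> 4"
    using rank_range [OF A, of x] x by auto
  moreover have "rk x \<noteq> -1" "rk x \<noteq> 4"
    using neq face_extreme [OF B A, of "rk x"] by auto
  ultimately have j: "0 \<le> rk x" "rk x \<le> 3"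
    by auto
  have "adj A (rk x) = B"
    by (rule adj_eqI [OF A j B neq same])
  then show thesis
    using that j by blast
qed

text \<open>By \<open>aut_adj\<close> the fixed flags are closed under adjacency, so by
  connectedness all flags are fixed. Every face lies in a flag and is determined there by its rank,
  which automorphisms preserve.\<close>

lemma aut_eq_one:
  assumes f: "f \<in> carrier \<Gamma>" and \<Phi>: "flag P leq \<Phi>" and fixed: "f ` \<Phi> = \<Phi>"
  shows "f = \<one>\<^bsub>\<Gamma>\<^esub>"
proof -
  have fix_flag: "f ` \<Psi> = \<Psi>" if \<Psi>: "flag P leq \<Psi>" for \<Psi>
  proof -
    have "(\<lambda>A B. flag P leq A \<and> flag P leq B \<and> \<Phi> \<inter> \<Psi> \<subseteq> A \<and> \<Phi> \<inter> \<Psi> \<subseteq> B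
               \<and> card (A - B) = 1)\<^sup>*\<^sup>* \<Phi> \<Psi>"
      using sfc \<Phi> \<Psi> unfolding strongly_flag_connected_def by simp
    then show ?thesis
    proof (induction rule: rtranclp_induct)
      case (step A B)
      then obtain j where "0 \<le> j" "j \<le> 3" "B = adj A j"
        by (auto elim: adjacent_flag_eq_adj)
      then show ?case
        using step f by (simp add: aut_adj)
    qed (fact fixed)
  qed
  have "f x = x" if x: "x \<in> P" for x
  proof -
    obtain \<Psi> where \<Psi>: "flag P leq \<Psi>" "x \<in> \<Psi>"
      using in_some_flag [OF x] by metis
    then have "face (f ` \<Psi>) (rk x) = f x"
      using face_eqI [OF aut_flag [OF f \<Psi>(1)]] aut_rank [OF f x] by auto
    then show ?thesis
      using fix_flag \<Psi> face_rank by simp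
  qed
  then show ?thesis
    using f by (auto simp: autgrp_def Bij_def extensional_def fun_eq_iff)
qed

text \<open>In each product the inner adjacencies of equal rank cancel, and the base flag goes to
  \<open>adj (adj \<Phi> j) i\<close> with \<open>i + 2 \<le> j\<close>. These two adjacencies
  commute, so the square fixes the base flag.\<close>

lemma rotation_products:
  assumes \<Phi>: "flag P leq \<Phi>"
    and s: "s1 \<in> carrier \<Gamma>" "s2 \<in> carrier \<Gamma>" "s3 \<in> carrier \<Gamma>"
    and img: "s1 ` \<Phi> = adj (adj \<Phi> 1) 0" "s2 ` \<Phi> = adj (adj \<Phi> 2) 1" "s3 ` \<Phi> = adj (adj \<Phi> 3) 2"
  shows "(s1 \<otimes>\<^bsub>\<Gamma>\<^esub> s2) \<otimes>\<^bsub>\<Gamma>\<^esub> (s1 \<otimes>\<^bsub>\<Gamma>\<^esub> s2) = \<one>\<^bsub>\<Gamma>\<^esub>"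
    and "(s2 \<otimes>\<^bsub>\<Gamma>\<^esub> s3) \<otimes>\<^bsub>\<Gamma>\<^esub> (s2 \<otimes>\<^bsub>\<Gamma>\<^esub> s3) = \<one>\<^bsub>\<Gamma>\<^esub>"
    and "(s1 \<otimes>\<^bsub>\<Gamma>\<^esub> s2 \<otimes>\<^bsub>\<Gamma>\<^esub> s3) \<otimes>\<^bsub>\<Gamma>\<^esub> (s1 \<otimes>\<^bsub>\<Gamma>\<^esub> s2 \<otimes>\<^bsub>\<Gamma>\<^esub> s3) = \<one>\<^bsub>\<Gamma>\<^esub>"
proof -
  have fl: "flag P leq (adj \<Psi> j)" if "flag P leq \<Psi>" "j \<in> {0, 1, 2, 3}" for \<Psi> j
    using that by (auto intro: adj_is_flag)
  have half_turn: "g \<otimes>\<^bsub>\<Gamma>\<^esub> g = \<one>\<^bsub>\<Gamma>\<^esub>"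
    if g: "g \<in> carrier \<Gamma>" "g ` \<Phi> = adj (adj \<Phi> j) i" and ij: "0 \<le> i" "i + 2 \<le> j" "j \<le> 3" for g i j
  proof (rule aut_eq_one [OF _ \<Phi>])
    have bounds: "i \<le> 3" "0 \<le> j"
      using ij by auto
    have "(g \<otimes>\<^bsub>\<Gamma>\<^esub> g) ` \<Phi> = adj (adj (adj (adj \<Phi> i) j) j) i"
      using g \<Phi> ij bounds by (simp add: aut_image_mult flag_subset_P aut_adj adj_is_flag adj_commute)
    then show "(g \<otimes>\<^bsub>\<Gamma>\<^esub> g) ` \<Phi> = \<Phi>"
      using \<Phi> ij bounds by (simp add: adj_adj adj_is_flag)
  qed (use g in simp)
  have "(s1 \<otimes>\<^bsub>\<Gamma>\<^esub> s2) ` \<Phi> = adj (adj \<Phi> 2) 0"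
    using s img \<Phi> by (simp add: aut_image_mult flag_subset_P aut_adj fl adj_adj)
  moreover from this have "(s1 \<otimes>\<^bsub>\<Gamma>\<^esub> s2 \<otimes>\<^bsub>\<Gamma>\<^esub> s3) ` \<Phi> = adj (adj \<Phi> 3) 0"
    using s img \<Phi> by (simp add: aut_image_mult flag_subset_P aut_adj fl adj_adj)
  moreover have "(s2 \<otimes>\<^bsub>\<Gamma>\<^esub> s3) ` \<Phi> = adj (adj \<Phi> 3) 1"
    using s img \<Phi> by (simp add: aut_image_mult flag_subset_P aut_adj fl adj_adj)
  ultimately show "(s1 \<otimes>\<^bsub>\<Gamma>\<^esub> s2) \<otimes>\<^bsub>\<Gamma>\<^esub> (s1 \<otimes>\<^bsub>\<Gamma>\<^esub> s2) = \<one>\<^bsub>\<Gamma>\<^esub>"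
    "(s2 \<otimes>\<^bsub>\<Gamma>\<^esub> s3) \<otimes>\<^bsub>\<Gamma>\<^esub> (s2 \<otimes>\<^bsub>\<Gamma>\<^esub> s3) = \<one>\<^bsub>\<Gamma>\<^esub>"
    "(s1 \<otimes>\<^bsub>\<Gamma>\<^esub> s2 \<otimes>\<^bsub>\<Gamma>\<^esub> s3) \<otimes>\<^bsub>\<Gamma>\<^esub> (s1 \<otimes>\<^bsub>\<Gamma>\<^esub> s2 \<otimes>\<^bsub>\<Gamma>\<^esub> s3) = \<one>\<^bsub>\<Gamma>\<^esub>"
    using s by (auto intro!: half_turn)
qed

text \<open>Evaluation at \<open>face \<Phi> j\<close> maps the cyclic group generated by
  \<open>s\<close> bijectively onto the vertices of the polygonal section between ranks
  \<open>j - 1\<close> and \<open>j + 2\<close>.\<close>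

lemma ord_rotation:
  assumes \<Phi>: "flag P leq \<Phi>" and s: "s \<in> carrier \<Gamma>"
    and j: "0 \<le> j" "j \<le> 2" and img: "s ` \<Phi> = adj (adj \<Phi> (j + 1)) j"
    and chiral: "adj \<Phi> (j + 1) \<notin> flag_orbit P leq \<Phi>"
  shows "aut.ord s = card {H \<in> P. leq (face \<Phi> (j - 1)) H \<and> leq H (face \<Phi> (j + 2)) \<and> rk H = j}"
    (is "_ = card ?S")
proof -
  have j1: "0 \<le> j + 1" "j + 1 \<le> 3" "j \<le> 3"
    using j by auto
  \<comment> \<open>The ranks that \<open>s\<close> leaves alone; \<open>A\<close> is the pointwise
    stabiliser of the corresponding chain.\<close>
  define I where "I = {-1..4} - {j, j + 1}"
  define A where "A = {g \<in> carrier \<Gamma>. \<forall>i\<in>I. g (face \<Phi> i) = face \<Phi> i}"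
  have face_P: "face \<Phi> i \<in> P" if "i \<in> I \<or> i = j" for i
    using that j face_in_P [OF \<Phi>, of i] by (auto simp: I_def)
  have flag1: "flag P leq (adj \<Phi> (j + 1))"
    using \<Phi> j1 by (simp add: adj_is_flag)
  have subgroup_A: "subgroup A \<Gamma>"
  proof (rule aut.subgroupI)
    show "A \<noteq> {}"
      using aut_one_apply face_P by (auto simp: A_def intro!: exI [of _ "\<one>\<^bsub>\<Gamma>\<^esub>"])
    show "inv\<^bsub>\<Gamma>\<^esub> g \<in> A" if g: "g \<in> A" for g
    proof -
      have "(inv\<^bsub>\<Gamma>\<^esub> g) (face \<Phi> i) = face \<Phi> i" if "i \<in> I" for i
      proof -
        have "(g \<otimes>\<^bsub>\<Gamma>\<^esub> inv\<^bsub>\<Gamma>\<^esub> g) (face \<Phi> i) = face \<Phi> i"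
          using g that face_P by (simp add: A_def aut_one_apply)
        then show ?thesis
          using g that face_P by (simp add: A_def aut_mult_apply)
      qed
      then show ?thesis
        using g by (simp add: A_def)
    qed
  qed (auto simp: A_def aut_mult_apply face_P)
  have "s (face \<Phi> i) = face \<Phi> i" if "i \<in> I" for i
  proof -
    have i: "-1 \<le> i" "i \<le> 4" "i \<noteq> j" "i \<noteq> j + 1"
      using that by (auto simp: I_def)
    then show ?thesis
      using aut_face [OF s \<Phi> i(1,2)] \<Phi> flag1 j j1 by (simp add: img face_adj_other)
  qed
  then have "s \<in> A"
    using s by (simp add: A_def)
  then have gen_A: "generate \<Gamma> {s} \<subseteq> A"
    using aut.generate_subgroup_incl [OF _ subgroup_A] by simp
  have gen: "generate \<Gamma> {s} = {s [^]\<^bsub>\<Gamma>\<^esub> n |n. n \<in> (UNIV :: int set)}"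
    by (rule aut.generate_pow [OF s])
  have "bij_betw (\<lambda>g. g (face \<Phi> j)) (generate \<Gamma> {s}) ?S"
    unfolding bij_betw_def
  proof
    \<comment> \<open>Such an element maps the base flag to itself or to its adjacent flag at rank
      \<open>j + 1\<close>, and chirality excludes the latter.\<close>
    have trivial_stab: "g = \<one>\<^bsub>\<Gamma>\<^esub>" if g: "g \<in> A" "g (face \<Phi> j) = face \<Phi> j" for g
    proof (rule aut_eq_one [OF _ \<Phi>])
      show gc: "g \<in> carrier \<Gamma>"
        using g by (simp add: A_def)
      have faces: "face (g ` \<Phi>) i = face \<Phi> i" if "-1 \<le> i" "i \<le> 4" "i \<noteq> j + 1" for i
        using that g aut_face [OF gc \<Phi>] by (cases "i = j") (auto simp: A_def I_def)
      have "adj \<Phi> (j + 1) = g ` \<Phi>" if "face (g ` \<Phi>) (j + 1) \<noteq> face \<Phi> (j + 1)"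
        using faces by (intro adj_eqI [OF \<Phi> j1(1,2) aut_flag [OF gc \<Phi>] that])
      moreover have "g ` \<Phi> \<in> flag_orbit P leq \<Phi>"
        using gc by (simp add: flag_orbit_def)
      ultimately have "face (g ` \<Phi>) (j + 1) = face \<Phi> (j + 1)"
        using chiral by metis
      then show "g ` \<Phi> = \<Phi>"
        using faces by (intro flag_eqI [OF aut_flag [OF gc \<Phi>] \<Phi>]) metis
    qed
    show "inj_on (\<lambda>g. g (face \<Phi> j)) (generate \<Gamma> {s})"
    proof (rule inj_onI)
      fix g h assume g: "g \<in> generate \<Gamma> {s}" and h: "h \<in> generate \<Gamma> {s}"
        and eq: "g (face \<Phi> j) = h (face \<Phi> j)"
      have gh: "g \<in> A" "h \<in> A" "g \<in> carrier \<Gamma>" "h \<in> carrier \<Gamma>"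
        using g h gen_A by (auto simp: A_def)
      have "(g \<otimes>\<^bsub>\<Gamma>\<^esub> inv\<^bsub>\<Gamma>\<^esub> h) (face \<Phi> j) = (h \<otimes>\<^bsub>\<Gamma>\<^esub> inv\<^bsub>\<Gamma>\<^esub> h) (face \<Phi> j)"
        using face_P eq by (simp add: aut_mult_apply del: aut.r_inv)
      also have "\<dots> = face \<Phi> j"
        using gh face_P by (simp add: aut_one_apply)
      finally have "g \<otimes>\<^bsub>\<Gamma>\<^esub> inv\<^bsub>\<Gamma>\<^esub> h = \<one>\<^bsub>\<Gamma>\<^esub>"
        using gh subgroup_A by (intro trivial_stab) (auto intro: subgroup.m_closed subgroup.m_inv_closed)
      then show "g = h"
        using gh by (metis aut.inv_closed aut.inv_equality aut.inv_inv)
    qed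
    show "(\<lambda>g. g (face \<Phi> j)) ` generate \<Gamma> {s} = ?S"
    proof
      have ends: "j - 1 \<in> I" "j + 2 \<in> I"
        using j by (auto simp: I_def)
      show "(\<lambda>g. g (face \<Phi> j)) ` generate \<Gamma> {s} \<subseteq> ?S"
      proof clarify
        fix g assume "g \<in> generate \<Gamma> {s}"
        then have g: "g \<in> carrier \<Gamma>" "\<forall>i\<in>I. g (face \<Phi> i) = face \<Phi> i"
          using gen_A by (auto simp: A_def)
        have "leq (g (face \<Phi> (j - 1))) (g (face \<Phi> j))" "leq (g (face \<Phi> j)) (g (face \<Phi> (j + 2)))"
          using aut_leq [OF g(1)] face_P ends j by (simp_all add: face_leq [OF \<Phi>])
        then show "g (face \<Phi> j) \<in> P \<and> leq (face \<Phi> (j - 1)) (g (face \<Phi> j))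
            \<and> leq (g (face \<Phi> j)) (face \<Phi> (j + 2)) \<and> rk (g (face \<Phi> j)) = j"
          using g ends face_P aut_in_P aut_rank rank_face [OF \<Phi>, of j] j by simp
      qed
      show "?S \<subseteq> (\<lambda>g. g (face \<Phi> j)) ` generate \<Gamma> {s}"
      proof
        fix H assume H: "H \<in> ?S"
        \<comment> \<open>The flag through \<open>H\<close> shares with \<open>\<Phi>\<close> all
          faces of ranks in \<open>I\<close>, so the path given by strong flag-connectedness can
          only change ranks \<open>j\<close> and \<open>j + 1\<close>.\<close>
        have "pchain P leq (insert H {x \<in> \<Phi>. rk x \<le> j - 1 \<or> j + 2 \<le> rk x})"
          by (rule insert_pchain [OF \<Phi>]) (use H j in auto)
        then obtain \<Psi> where \<Psi>: "flag P leq \<Psi>" "insert H {x \<in> \<Phi>. rk x \<le> j - 1 \<or> j + 2 \<le> rk x} \<subseteq> \<Psi>"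
          by (rule pchain_subset_flag)
        \<comment> \<open>The flags met when walking around the polygon: images of
          \<open>\<Phi>\<close> under powers of \<open>s\<close> and their adjacent flags at rank
          \<open>j + 1\<close>. The family is closed under both adjacencies, since by
          \<open>step_n\<close> one more power of \<open>s\<close> changes rank \<open>j + 1\<close>
          and then rank \<open>j\<close>.\<close>
        define K where "K B \<longleftrightarrow> (\<exists>n::int. B = (s [^]\<^bsub>\<Gamma>\<^esub> n) ` \<Phi> \<or> B = adj ((s [^]\<^bsub>\<Gamma>\<^esub> n) ` \<Phi>) (j + 1))" for B
        have flag_n: "flag P leq ((s [^]\<^bsub>\<Gamma>\<^esub> n) ` \<Phi>)" for n :: int
          using s \<Phi> by (intro aut_flag) auto
        have step_n: "(s [^]\<^bsub>\<Gamma>\<^esub> (n + 1)) ` \<Phi> = adj (adj ((s [^]\<^bsub>\<Gamma>\<^esub> n) ` \<Phi>) (j + 1)) j" for n :: int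
        proof -
          have "s [^]\<^bsub>\<Gamma>\<^esub> (n + 1) = s \<otimes>\<^bsub>\<Gamma>\<^esub> s [^]\<^bsub>\<Gamma>\<^esub> n"
            using aut.int_pow_mult [OF s, of 1 n] s by (simp add: add.commute)
          then show ?thesis
            using s \<Phi> flag1 j j1 by (simp add: aut_image_mult flag_subset_P img aut_adj)
        qed
        have K_adj: "K (adj B i)" if K: "K B" and i: "i = j \<or> i = j + 1" for B i
        proof -
          obtain n :: int where n: "B = (s [^]\<^bsub>\<Gamma>\<^esub> n) ` \<Phi> \<or> B = adj ((s [^]\<^bsub>\<Gamma>\<^esub> n) ` \<Phi>) (j + 1)"
            using K unfolding K_def by auto
          have "(s [^]\<^bsub>\<Gamma>\<^esub> n) ` \<Phi> = adj (adj ((s [^]\<^bsub>\<Gamma>\<^esub> (n - 1)) ` \<Phi>) (j + 1)) j"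
            using step_n [of "n - 1"] by simp
          then have "adj ((s [^]\<^bsub>\<Gamma>\<^esub> n) ` \<Phi>) j = adj ((s [^]\<^bsub>\<Gamma>\<^esub> (n - 1)) ` \<Phi>) (j + 1)"
            using flag_n j j1 by (simp add: adj_adj adj_is_flag)
          moreover have "adj (adj ((s [^]\<^bsub>\<Gamma>\<^esub> n) ` \<Phi>) (j + 1)) (j + 1) = (s [^]\<^bsub>\<Gamma>\<^esub> n) ` \<Phi>"
            using flag_n j1 by (simp add: adj_adj)
          ultimately show ?thesis
            using n i step_n [of n] unfolding K_def by metis
        qed
        have common: "face \<Phi> i \<in> \<Phi> \<inter> \<Psi>" if "i \<in> I" for i
          using that \<Psi>(2) face_in [OF \<Phi>, of i] rank_face [OF \<Phi>, of i] by (auto simp: I_def)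
        have "(\<lambda>A B. flag P leq A \<and> flag P leq B \<and> \<Phi> \<inter> \<Psi> \<subseteq> A \<and> \<Phi> \<inter> \<Psi> \<subseteq> B
               \<and> card (A - B) = 1)\<^sup>*\<^sup>* \<Phi> \<Psi>"
          using sfc \<Phi> \<Psi>(1) unfolding strongly_flag_connected_def by simp
        then have "K \<Psi>"
        proof (induction rule: rtranclp_induct)
          case base
          have "(s [^]\<^bsub>\<Gamma>\<^esub> (0::int)) ` \<Phi> = \<Phi>"
            using aut_one_apply flag_subset_P [OF \<Phi>] by (auto simp: image_iff subset_eq)
          then show ?case
            unfolding K_def by metis
        next
          case (step B C)
          then have BC: "flag P leq B" "flag P leq C" "\<Phi> \<inter> \<Psi> \<subseteq> B" "\<Phi> \<inter> \<Psi> \<subseteq> C"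
            by auto
          obtain i where i: "0 \<le> i" "i \<le> 3" "C = adj B i"
            using step by (auto elim: adjacent_flag_eq_adj)
          \<comment> \<open>A change at a rank in \<open>I\<close> would remove a face common to
            \<open>\<Phi>\<close> and \<open>\<Psi>\<close>, which the path retains.\<close>
          have "i = j \<or> i = j + 1"
          proof (rule ccontr)
            assume "\<not> (i = j \<or> i = j + 1)"
            then have "i \<in> I"
              using i by (auto simp: I_def)
            then have "face B i = face \<Phi> i" "face C i = face \<Phi> i"
              using common [of i] BC rank_face [OF \<Phi>, of i] i by (auto intro!: face_eqI)
            then show False
              using face_adj_neq [OF BC(1) i(1,2)] i(3) by simp
          qed
          then show ?case
            using K_adj step.IH i(3) by simp
        qed
        then obtain n :: int where n: "\<Psi> = (s [^]\<^bsub>\<Gamma>\<^esub> n) ` \<Phi> \<or> \<Psi> = adj ((s [^]\<^bsub>\<Gamma>\<^esub> n) ` \<Phi>) (j + 1)"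
          unfolding K_def by auto
        have "face \<Psi> j = H"
          using \<Psi> H by (intro face_eqI) auto
        \<comment> \<open>Both forms of \<open>\<Psi>\<close> have the same face of rank
          \<open>j\<close>, as the adjacency is at rank \<open>j + 1\<close>.\<close>
        moreover have "face \<Psi> j = face ((s [^]\<^bsub>\<Gamma>\<^esub> n) ` \<Phi>) j"
          using n flag_n [of n] j j1 by (auto simp: face_adj_other)
        moreover have "face ((s [^]\<^bsub>\<Gamma>\<^esub> n) ` \<Phi>) j = (s [^]\<^bsub>\<Gamma>\<^esub> n) (face \<Phi> j)"
          using s \<Phi> j by (intro aut_face) auto
        ultimately show "H \<in> (\<lambda>g. g (face \<Phi> j)) ` generate \<Gamma> {s}"
          unfolding gen by auto
      qed
    qed
  qed
  then have "card (generate \<Gamma> {s}) = card ?S"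
    by (rule bij_betw_same_card)
  then show ?thesis
    using aut.generate_pow_card [OF s] by simp
qed

end

section \<open>Nonexistence\<close>

text \<open>Everything the group computation needs from the polytope. The orders are read off from
  sections at the base flag, from rank 0 to 3 for \<open>s2\<close> and from rank 1 to 4 for
  \<open>s3\<close>.\<close>

lemma chiral_std_gens:
  assumes chiral: "chiral4 P leq" and type: "has_type P leq p q r" and gens: "std_gens P leq \<Phi> s1 s2 s3"
  defines "\<Gamma> \<equiv> autgrp P leq"
  shows "group \<Gamma>" "s1 \<in> carrier \<Gamma>" "s2 \<in> carrier \<Gamma>" "s3 \<in> carrier \<Gamma>"
    and "(s1 \<otimes>\<^bsub>\<Gamma>\<^esub> s2) \<otimes>\<^bsub>\<Gamma>\<^esub> (s1 \<otimes>\<^bsub>\<Gamma>\<^esub> s2) = \<one>\<^bsub>\<Gamma>\<^esub>"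
    and "(s2 \<otimes>\<^bsub>\<Gamma>\<^esub> s3) \<otimes>\<^bsub>\<Gamma>\<^esub> (s2 \<otimes>\<^bsub>\<Gamma>\<^esub> s3) = \<one>\<^bsub>\<Gamma>\<^esub>"
    and "(s1 \<otimes>\<^bsub>\<Gamma>\<^esub> s2 \<otimes>\<^bsub>\<Gamma>\<^esub> s3) \<otimes>\<^bsub>\<Gamma>\<^esub> (s1 \<otimes>\<^bsub>\<Gamma>\<^esub> s2 \<otimes>\<^bsub>\<Gamma>\<^esub> s3) = \<one>\<^bsub>\<Gamma>\<^esub>"
    and "group.ord \<Gamma> s2 = q" "group.ord \<Gamma> s3 = r"
proof -
  interpret polytope P leq
    using chiral unfolding chiral4_def by unfold_locales simp
  have \<Phi>: "flag P leq \<Phi>"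
    and s: "s1 \<in> carrier \<Gamma>" "s2 \<in> carrier \<Gamma>" "s3 \<in> carrier \<Gamma>"
    and img: "s1 ` \<Phi> = adj (adj \<Phi> 1) 0" "s2 ` \<Phi> = adj (adj \<Phi> 2) 1" "s3 ` \<Phi> = adj (adj \<Phi> 3) 2"
    using gens unfolding std_gens_def \<Gamma>_def by simp_all
  show "group \<Gamma>" "s1 \<in> carrier \<Gamma>" "s2 \<in> carrier \<Gamma>" "s3 \<in> carrier \<Gamma>"
    using s group_aut by (simp_all add: \<Gamma>_def)
  show "(s1 \<otimes>\<^bsub>\<Gamma>\<^esub> s2) \<otimes>\<^bsub>\<Gamma>\<^esub> (s1 \<otimes>\<^bsub>\<Gamma>\<^esub> s2) = \<one>\<^bsub>\<Gamma>\<^esub>"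
    and "(s2 \<otimes>\<^bsub>\<Gamma>\<^esub> s3) \<otimes>\<^bsub>\<Gamma>\<^esub> (s2 \<otimes>\<^bsub>\<Gamma>\<^esub> s3) = \<one>\<^bsub>\<Gamma>\<^esub>"
    and "(s1 \<otimes>\<^bsub>\<Gamma>\<^esub> s2 \<otimes>\<^bsub>\<Gamma>\<^esub> s3) \<otimes>\<^bsub>\<Gamma>\<^esub> (s1 \<otimes>\<^bsub>\<Gamma>\<^esub> s2 \<otimes>\<^bsub>\<Gamma>\<^esub> s3) = \<one>\<^bsub>\<Gamma>\<^esub>"
    using rotation_products [OF \<Phi> _ _ _ img] s unfolding \<Gamma>_def by simp_all
  have not_orbit: "adj \<Phi> 2 \<notin> flag_orbit P leq \<Phi>" "adj \<Phi> 3 \<notin> flag_orbit P leq \<Phi>"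
    using chiral \<Phi> unfolding chiral4_def by auto
  have F: "face \<Phi> i \<in> P" "rk (face \<Phi> i) = i" if "i \<in> {0, 1, 3, 4}" for i
    using that face_in_P [OF \<Phi>, of i] rank_face [OF \<Phi>, of i] by auto
  have "card {H \<in> P. leq (face \<Phi> 0) H \<and> leq H (face \<Phi> 3) \<and> rk H = 1} = q"
    using type F face_leq [OF \<Phi>, of 0 3] unfolding has_type_def by simp
  then show "group.ord \<Gamma> s2 = q"
    using ord_rotation [OF \<Phi>, of s2 1] s img not_orbit by (simp add: \<Gamma>_def)
  have "card {H \<in> P. leq (face \<Phi> 1) H \<and> leq H (face \<Phi> 4) \<and> rk H = 2} = r"
    using type F face_leq [OF \<Phi>, of 1 4] unfolding has_type_def by simp
  then show "group.ord \<Gamma> s3 = r"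
    using ord_rotation [OF \<Phi>, of s3 2] s img not_orbit by (simp add: \<Gamma>_def)
qed

text \<open>The set-up common to both cases, with \<open>p = 2 ^ (\<beta> - 5)\<close>; its last
  claim is what the group computation will contradict.\<close>

lemma chiral_rotation_gens:
  assumes \<beta>: "\<beta> \<ge> 5"
    and chiral: "chiral4 P leq" and tight: "tight_of_type P leq m (2 ^ \<beta>) r"
    and gens: "std_gens P leq \<Phi> s1 s2 s3"
    and rel: "s2 \<otimes>\<^bsub>autgrp P leq\<^esub> inv\<^bsub>autgrp P leq\<^esub> s1
              = s1 \<otimes>\<^bsub>autgrp P leq\<^esub> s2 [^]\<^bsub>autgrp P leq\<^esub> (3 - \<epsilon>1 * 2^(\<beta>-1))"
  shows "rotation_gens (autgrp P leq) s1 s2 s3 (2 ^ (\<beta> - 5)) \<epsilon>1"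
    and "s3 [^]\<^bsub>autgrp P leq\<^esub> int r = \<one>\<^bsub>autgrp P leq\<^esub>"
    and "s2 [^]\<^bsub>autgrp P leq\<^esub> (16 * 2 ^ (\<beta> - 5) :: int) \<noteq> \<one>\<^bsub>autgrp P leq\<^esub>"
proof -
  have pow: "(2::int) ^ \<beta> = 32 * 2 ^ (\<beta> - 5)" "(2::int) ^ (\<beta> - 1) = 16 * 2 ^ (\<beta> - 5)"
  proof -
    obtain n where "\<beta> = n + 5"
      using \<beta> by (metis le_add_diff_inverse2)
    then show "(2::int) ^ \<beta> = 32 * 2 ^ (\<beta> - 5)" "(2::int) ^ (\<beta> - 1) = 16 * 2 ^ (\<beta> - 5)"
      by (simp_all add: power_add eval_nat_numeral)
  qed
  have "has_type P leq m (2 ^ \<beta>) r"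
    using tight by (simp add: tight_of_type_def)
  note facts = chiral_std_gens [OF chiral this gens]
  interpret G: group "autgrp P leq"
    by (rule facts)
  have "s2 [^]\<^bsub>autgrp P leq\<^esub> (2 ^ \<beta> :: int) = \<one>\<^bsub>autgrp P leq\<^esub>"
    using facts by (subst G.int_pow_eq_id) simp_all
  then show "rotation_gens (autgrp P leq) s1 s2 s3 (2 ^ (\<beta> - 5)) \<epsilon>1"
    using facts rel unfolding pow by unfold_locales simp_all
  show "s3 [^]\<^bsub>autgrp P leq\<^esub> int r = \<one>\<^bsub>autgrp P leq\<^esub>"
    using facts by (subst G.int_pow_eq_id) simp_all
  \<comment> \<open>The order of \<open>s2\<close> exceeds this positive exponent, hence cannot
    divide it.\<close>
  have "\<not> int (2 ^ \<beta>) dvd 16 * 2 ^ (\<beta> - 5)"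
    using pow zdvd_not_zless [of "16 * 2 ^ (\<beta> - 5)" "2 ^ \<beta>"] by simp
  then show "s2 [^]\<^bsub>autgrp P leq\<^esub> (16 * 2 ^ (\<beta> - 5) :: int) \<noteq> \<one>\<^bsub>autgrp P leq\<^esub>"
    using facts by (subst G.int_pow_eq_id) simp_all
qed

theorem theorem5p12:
  fixes \<beta> :: nat and \<epsilon>1 \<epsilon>2 :: int
  assumes "\<beta> \<ge> 5" and "\<epsilon>1 \<in> {0, 1}" and "\<epsilon>2 \<in> {1, -1}"
  shows "\<not> (\<exists>(P :: 'a set) leq \<Phi> s1 s2 s3.
            chiral4 P leq \<and> tight_of_type P leq (2^(\<beta>-1)) (2^\<beta>) 8 \<and>
            std_gens P leq \<Phi> s1 s2 s3 \<and>
            s2 \<otimes>\<^bsub>autgrp P leq\<^esub> inv\<^bsub>autgrp P leq\<^esub> s1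
              = s1 \<otimes>\<^bsub>autgrp P leq\<^esub> s2 [^]\<^bsub>autgrp P leq\<^esub> (3 - \<epsilon>1 * 2^(\<beta>-1)) \<and>
            s2 \<otimes>\<^bsub>autgrp P leq\<^esub> s3 [^]\<^bsub>autgrp P leq\<^esub> (2::int)
              = s3 [^]\<^bsub>autgrp P leq\<^esub> (2::int) \<otimes>\<^bsub>autgrp P leq\<^esub>
                  s2 [^]\<^bsub>autgrp P leq\<^esub> (1 + \<epsilon>2 * 2^(\<beta>-2)))
       \<and> \<not> (\<exists>(P :: 'a set) leq \<Phi> s1 s2 s3.
            chiral4 P leq \<and> tight_of_type P leq (2^(\<beta>-1)) (2^\<beta>) (2^(\<beta>-1)) \<and>
            std_gens P leq \<Phi> s1 s2 s3 \<and>
            s2 \<otimes>\<^bsub>autgrp P leq\<^esub> inv\<^bsub>autgrp P leq\<^esub> s1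
              = s1 \<otimes>\<^bsub>autgrp P leq\<^esub> s2 [^]\<^bsub>autgrp P leq\<^esub> (3 - \<epsilon>1 * 2^(\<beta>-1)) \<and>
            inv\<^bsub>autgrp P leq\<^esub> s3 \<otimes>\<^bsub>autgrp P leq\<^esub> s2
              = s2 [^]\<^bsub>autgrp P leq\<^esub> (3 + \<epsilon>2 * 2^(\<beta>-2)) \<otimes>\<^bsub>autgrp P leq\<^esub>
                  s3 [^]\<^bsub>autgrp P leq\<^esub> (1 - 2^(\<beta>-2) :: int) \<and>
            s3 \<otimes>\<^bsub>autgrp P leq\<^esub> inv\<^bsub>autgrp P leq\<^esub> s2
              = s2 [^]\<^bsub>autgrp P leq\<^esub> (-3 + \<epsilon>2 * 2^(\<beta>-2)) \<otimes>\<^bsub>autgrp P leq\<^esub>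
                  s3 [^]\<^bsub>autgrp P leq\<^esub> (-1 + 2^(\<beta>-2) :: int))"
proof -
  obtain n where n: "\<beta> = n + 5"
    using assms(1) by (metis le_add_diff_inverse2)
  \<comment> \<open>These put the remaining relations, and the order of \<open>s3\<close> in case
    (b), into the form with \<open>8 * p\<close> and \<open>16 * p\<close>.\<close>
  have pow: "(2::int) ^ (\<beta> - 2) = 8 * 2 ^ (\<beta> - 5)" "int (2 ^ (\<beta> - 1)) = 16 * 2 ^ (\<beta> - 5)"
    unfolding n by (simp_all add: power_add eval_nat_numeral)
  have odd: "odd \<epsilon>2"
    using assms(3) by auto
  show ?thesis
  proof (intro conjI notI; elim exE conjE)
    fix P :: "'a set" and leq \<Phi> s1 s2 s3
    assume hyps: "chiral4 P leq" "tight_of_type P leq (2^(\<beta>-1)) (2^\<beta>) 8" "std_gens P leq \<Phi> s1 s2 s3"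
      "s2 \<otimes>\<^bsub>autgrp P leq\<^esub> inv\<^bsub>autgrp P leq\<^esub> s1
        = s1 \<otimes>\<^bsub>autgrp P leq\<^esub> s2 [^]\<^bsub>autgrp P leq\<^esub> (3 - \<epsilon>1 * 2^(\<beta>-1))"
      and rel: "s2 \<otimes>\<^bsub>autgrp P leq\<^esub> s3 [^]\<^bsub>autgrp P leq\<^esub> (2::int)
        = s3 [^]\<^bsub>autgrp P leq\<^esub> (2::int) \<otimes>\<^bsub>autgrp P leq\<^esub>
            s2 [^]\<^bsub>autgrp P leq\<^esub> (1 + \<epsilon>2 * 2^(\<beta>-2))"
    note gens = chiral_rotation_gens [OF assms(1) hyps]
    show False
      using rotation_gens.half_power_trivial_of_c_pow_8 [OF gens(1) _ odd] gens(2,3) rel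
      unfolding pow by simp
  next
    fix P :: "'a set" and leq \<Phi> s1 s2 s3
    assume hyps: "chiral4 P leq" "tight_of_type P leq (2^(\<beta>-1)) (2^\<beta>) (2^(\<beta>-1))"
      "std_gens P leq \<Phi> s1 s2 s3"
      "s2 \<otimes>\<^bsub>autgrp P leq\<^esub> inv\<^bsub>autgrp P leq\<^esub> s1
        = s1 \<otimes>\<^bsub>autgrp P leq\<^esub> s2 [^]\<^bsub>autgrp P leq\<^esub> (3 - \<epsilon>1 * 2^(\<beta>-1))"
      and rels: "inv\<^bsub>autgrp P leq\<^esub> s3 \<otimes>\<^bsub>autgrp P leq\<^esub> s2
        = s2 [^]\<^bsub>autgrp P leq\<^esub> (3 + \<epsilon>2 * 2^(\<beta>-2)) \<otimes>\<^bsub>autgrp P leq\<^esub>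
            s3 [^]\<^bsub>autgrp P leq\<^esub> (1 - 2^(\<beta>-2) :: int)"
      "s3 \<otimes>\<^bsub>autgrp P leq\<^esub> inv\<^bsub>autgrp P leq\<^esub> s2
        = s2 [^]\<^bsub>autgrp P leq\<^esub> (-3 + \<epsilon>2 * 2^(\<beta>-2)) \<otimes>\<^bsub>autgrp P leq\<^esub>
            s3 [^]\<^bsub>autgrp P leq\<^esub> (-1 + 2^(\<beta>-2) :: int)"
    note gens = chiral_rotation_gens [OF assms(1) hyps]
    show False
      using rotation_gens.half_power_trivial_of_c_pow_16p [OF gens(1) _ rels [unfolded pow]] gens(2,3)
      unfolding pow by simp
  qed
qed

end
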